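(* Let $n\ge0$ and $0\le m\le n$ be integers. Let the variables be related by $x_i=-(1+t_i+t_i^{-1})$ and $y_i=3/(1+u_i+u_i^{-1})$. Then, as identities of rational functions of the $t_i,u_i$ (the limits being taken after substitution, as $\zeta\to-2$), $$\lim_{\zeta\to-2}(\zeta+2)^{2mn-m(m-1)}S_n\Big(x_1,\dots,x_{2n+1-2m},\tfrac{\zeta y_1}{\zeta+2},\dots,\tfrac{\zeta y_{2m}}{\zeta+2}\Big)$$ $$=2^{(2m+n)n-m(m-1)}3^{2mn-m(m-1)}\prod_{i=1}^{2m}\frac1{(1+u_i+u_i^{-1})^{n}}\ \chi^{\mathfrak{so}(4n-4m+3)}_{(n-m,n-m,n-m-1,n-m-1,\dots,1,1,0)}(t_1,\dots,t_{2n-2m+1})\ \chi^{\mathfrak{sp}(4m)}_{(m-1,m-1,\dots,1,1,0,0)}(u_1,\dots,u_{2m}),$$ and $$\lim_{\zeta\to-2}(\zeta+2)^{(2m+1)n-m^2}S_n\Big(x_1,\dots,x_{2n-2m},\tfrac{\zeta y_1}{\zeta+2},\dots,\tfrac{\zeta y_{2m+1}}{\zeta+2}\Big)$$ $$=2^{(2m+n+1)n-m^2}3^{(2m+1)n-m^2}\prod_{i=1}^{2m+1}\frac1{(1+u_i+u_i^{-1})^{n}}\ \chi^{\mathfrak{so}(4n-4m+1)}_{(n-m,n-m-1,n-m-1,\dots,1,1,0)}(t_1,\dots,t_{2n-2m})\ \chi^{\mathfrak{sp}(4m+2)}_{(m,m-1,m-1,\dots,1,1,0,0)}(u_1,\dots,u_{2m+1}).$$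 Here the partition $(n-m,n-m,\dots,1,1,0)$ has length $2(n-m)+1$, $(m-1,m-1,\dots,1,1,0,0)$ has length $2m$, $(n-m,n-m-1,n-m-1,\dots,1,1,0)$ has length $2(n-m)$, and $(m,m-1,m-1,\dots,1,1,0,0)$ has length $2m+1$.
   Context: Let $\zeta$ be an indeterminate. Define $F(x,y,z)=(\zeta+2)xyz-\zeta(xy+yz+xz+x+y+z)+\zeta(2\zeta+1)$ and $G(x,y)=(\zeta+2)xy(x+y)-\zeta(x^2+y^2)-2(\zeta^2+3\zeta+1)xy+\zeta(2\zeta+1)(x+y)$. For $n\ge 0$ let $$S_n(x_1,\dots,x_n,y_1,\dots,y_n,z)=\frac{\prod_{i,j=1}^nG(x_i,y_j)}{\prod_{1\le i<j\le n}(x_j-x_i)(y_j-y_i)}\det_{1\le i,j\le n}\left(\frac{F(x_i,y_j,z)}{G(x_i,y_j)}\right)$$ ($S_0=1$); it is a polynomial in all variables and $\zeta$, symmetric in all $2n+1$ variables, so its arguments may be listed in any order. For a partition $\lambda=(\lambda_1,\dots,\lambda_N)$, $$\chi^{\mathfrak{sp}(2N)}_\lambda(t_1,\dots,t_N)=\frac{\det_{1\le i,j\le N}\big(t_j^{-(\lambda_i+N-i+1)}-t_j^{\lambda_i+N-i+1}\big)}{\prod_{i=1}^Nt_i^{-N}(1-t_i^2)\prod_{1\le i<j\le N}(t_j-t_i)(1-t_it_j)},\quad \chi^{\mathfrak{so}(2N+1)}_\lambda(t_1,\dots,t_N)=\frac{\det_{1\le i,j\le N}\big(t_j^{-(\lambda_i+N-i+\frac12)}-t_j^{\lambda_i+N-i+\frac12}\big)}{\prod_{i=1}^Nt_i^{\frac12-N}(1-t_i)\prod_{1\le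 i<j\le N}(t_j-t_i)(1-t_it_j)},$$ with the convention that a character in $N=0$ variables equals $1$. *)

theory Defs
  imports "HOL-Analysis.Complex_Transcendental" "Jordan_Normal_Form.Determinant"
begin

text \<open>Families of variables are functions on \<open>nat\<close>, used at the indices \<open>1, 2, \<dots>\<close>.\<close>

definition det_upto :: "nat \<Rightarrow> (nat \<Rightarrow> nat \<Rightarrow> complex) \<Rightarrow> complex" where
  "det_upto N a = Determinant.det (Matrix.mat N N (\<lambda>(i, j). a (Suc i) (Suc j)))"

definition F_poly :: "complex \<Rightarrow> complex \<Rightarrow> complex \<Rightarrow> complex \<Rightarrow> complex" where
  "F_poly \<zeta> x y z =
     (\<zeta> + 2) * x * y * z - \<zeta> * (x * y + y * z + x * z + x + y + z) + \<zeta> * (2 * \<zeta> + 1)"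

definition G_poly :: "complex \<Rightarrow> complex \<Rightarrow> complex \<Rightarrow> complex" where
  "G_poly \<zeta> x y =
     (\<zeta> + 2) * x * y * (x + y) - \<zeta> * (x\<^sup>2 + y\<^sup>2) - 2 * (\<zeta>\<^sup>2 + 3 * \<zeta> + 1) * x * y
     + \<zeta> * (2 * \<zeta> + 1) * (x + y)"

text \<open>
  The value of \<open>S\<^sub>n\<close> at \<open>v 1, \<dots>, v (2 * n + 1)\<close>, where \<open>x\<^sub>i = v i\<close>, \<open>y\<^sub>j = v (n + j)\<close> and
  \<open>z = v (2 * n + 1)\<close>. The quotient gives the value of the polynomial \<open>S\<^sub>n\<close> only where no
  denominator vanishes. In the limits \<open>\<zeta> \<rightarrow> -2\<close> considered here this is the case throughout
  a punctured neighbourhood of \<open>-2\<close>: the arguments there are pairwise distinct as soon as the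
  denominators of the two characters are nonzero, and then each \<open>G (x\<^sub>i, y\<^sub>j)\<close>, as a rational
  function of \<open>\<zeta>\<close>, is not identically zero.
\<close>
definition S_poly :: "nat \<Rightarrow> complex \<Rightarrow> (nat \<Rightarrow> complex) \<Rightarrow> complex" where
  "S_poly n \<zeta> v =
     (let x = v; y = (\<lambda>j. v (n + j)); z = v (2 * n + 1) in
       (\<Prod>i=1..n. \<Prod>j=1..n. G_poly \<zeta> (x i) (y j))
       / (\<Prod>i=1..n. \<Prod>j=i+1..n. (x j - x i) * (y j - y i))
       * det_upto n (\<lambda>i j. F_poly \<zeta> (x i) (y j) z / G_poly \<zeta> (x i) (y j)))"

definition join_args :: "nat \<Rightarrow> (nat \<Rightarrow> complex) \<Rightarrow> (nat \<Rightarrow> complex) \<Rightarrow> nat \<Rightarrow> complex" where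
  "join_args p a b i = (if i \<le> p then a i else b (i - p))"

definition sp_denom :: "nat \<Rightarrow> (nat \<Rightarrow> complex) \<Rightarrow> complex" where
  "sp_denom N t =
     (\<Prod>i=1..N. t i powi (- int N) * (1 - (t i)\<^sup>2))
     * (\<Prod>i=1..N. \<Prod>j=i+1..N. (t j - t i) * (1 - t i * t j))"

text \<open>The character of \<open>sp(2N)\<close> indexed by the partition \<open>(l 1, \<dots>, l N)\<close>.\<close>
definition sp_char :: "nat \<Rightarrow> (nat \<Rightarrow> nat) \<Rightarrow> (nat \<Rightarrow> complex) \<Rightarrow> complex" where
  "sp_char N l t =
     det_upto N (\<lambda>i j. t j powi (- (int (l i) + int N - int i + 1))
                       - t j powi (int (l i) + int N - int i + 1))
     / sp_denom N t"

text \<open>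
  The character of \<open>so(2N+1)\<close>. The half-integral powers are principal values; the quotient does
  not depend on the choice of the square roots, since changing the sign of the root of \<open>t j\<close>
  changes the sign of both the numerator and the denominator.
\<close>
definition so_denom :: "nat \<Rightarrow> (nat \<Rightarrow> complex) \<Rightarrow> complex" where
  "so_denom N t =
     (\<Prod>i=1..N. t i powr (1/2 - of_nat N) * (1 - t i))
     * (\<Prod>i=1..N. \<Prod>j=i+1..N. (t j - t i) * (1 - t i * t j))"

definition so_char :: "nat \<Rightarrow> (nat \<Rightarrow> nat) \<Rightarrow> (nat \<Rightarrow> complex) \<Rightarrow> complex" where
  "so_char N l t =
     det_upto N (\<lambda>i j. t j powr (- (of_nat (l i) + of_nat N - of_nat i + 1/2))
                       - t j powr (of_nat (l i) + of_nat N - of_nat i + 1/2))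
     / so_denom N t"

text \<open>
  For \<open>i = 1, 2, \<dots>\<close> these are \<open>(k, k, k-1, k-1, \<dots>, 1, 1, 0, 0)\<close> and
  \<open>(k, k-1, k-1, \<dots>, 1, 1, 0, 0)\<close>; the number of variables of the character determines
  how many of the entries are used.
\<close>
definition pairs_part :: "nat \<Rightarrow> nat \<Rightarrow> nat" where
  "pairs_part k i = k - (i - 1) div 2"

definition single_pairs_part :: "nat \<Rightarrow> nat \<Rightarrow> nat" where
  "single_pairs_part k i = k - i div 2"

definition x_of :: "complex \<Rightarrow> complex" where
  "x_of t = - (1 + t + inverse t)"

definition y_of :: "complex \<Rightarrow> complex" where
  "y_of u = 3 / (1 + u + inverse u)"

text \<open>
  Points at which all the rational functions of \<open>t 1, \<dots>, t p\<close> and \<open>u 1, \<dots>, u q\<close> in the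
  statement are defined.
\<close>
definition regular_point :: "nat \<Rightarrow> nat \<Rightarrow> (nat \<Rightarrow> complex) \<Rightarrow> (nat \<Rightarrow> complex) \<Rightarrow> bool" where
  "regular_point p q t u \<longleftrightarrow>
     (\<forall>i\<in>{1..p}. t i \<noteq> 0) \<and> (\<forall>i\<in>{1..q}. u i \<noteq> 0 \<and> 1 + u i + inverse (u i) \<noteq> 0) \<and>
     so_denom p t \<noteq> 0 \<and> sp_denom q u \<noteq> 0"

end

theory Submission
  imports Defs
begin

text \<open>
  Put \<open>P(x) = x\<^sup>2(x - 2\<zeta> - 1)\<close>, \<open>Q(x) = (\<zeta> + 2)x - \<zeta>\<close> and \<open>R(x) = x(x + 1)\<close>. Then
  \<open>(x - y)G(x, y)\<close> is the \<open>2 \<times> 2\<close> alternant of \<open>P, Q\<close>, and \<open>F(x, y, z)\<close> times the Vandermonde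
  product of \<open>x, y, z\<close> is the \<open>3 \<times> 3\<close> alternant of \<open>P, Q, R\<close>. Lagrange interpolation in \<open>P/Q\<close>
  therefore turns \<open>S\<^sub>n\<close> into the quotient, by the Vandermonde product of all \<open>2n + 1\<close> variables, of the
  alternant of the functions \<open>P\<^sup>jQ\<^sup>n\<^sup>-\<^sup>j\<close> (\<open>j \<le> n\<close>) and \<open>R P\<^sup>jQ\<^sup>n\<^sup>-\<^sup>1\<^sup>-\<^sup>j\<close> (\<open>j < n\<close>).

  At \<open>\<zeta>y/(\<zeta> + 2)\<close> these functions have poles of pairwise distinct orders at \<open>\<zeta> = -2\<close>, so in the limit
  the alternant factors into one in the \<open>x\<^sub>i\<close> and one in the \<open>y\<^sub>i\<close>. At \<open>\<zeta> = -2\<close> one has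
  \<open>P = 2 - t\<^sup>3 - t\<^sup>-\<^sup>3\<close>, and a unitriangular change of basis identifies the two factors with the
  numerators of the characters.
\<close>

section \<open>Determinants\<close>

text \<open>The quotient defining S_n separates its arguments into n, n and 1, whereas the limit
  separates them at an arbitrary place p; an alternant in all arguments lets the cut be moved
  freely.

  The order of the functions matters. As Q^n times 1, R/Q, P/Q, (R/Q)(P/Q), (P/Q)^2, ... they have
  pole orders 0, 2, 3, 5, 6, ..., so the finite arguments keep the first p functions and the
  infinite ones the last q. The power of \<zeta> + 2 in the theorem is the excess of the pole order
  of these q columns over that of the Vandermonde product.

  The cubic P is the source of the repeated parts of the partitions: multiplication by t^3 + t^-3
  moves exponents by 3, and the exponents in the symplectic character are those congruent to 1 or -1
  mod 3, while the doubled exponents in the orthogonal one are congruent to 1 or -1 mod 6.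

  The value of G at distinct arguments can vanish at \<zeta> = -2, for instance when the cubes of
  two of the t_i agree. Hence the quotient is evaluated only in a punctured neighbourhood of -2,
  never at the point itself.\<close>

definition fdet :: "nat \<Rightarrow> (nat \<Rightarrow> nat \<Rightarrow> 'a :: field) \<Rightarrow> 'a" where
  "fdet N f = Determinant.det (Matrix.mat N N (\<lambda>(i, j). f i j))"

lemma fdet_cong:
  assumes "\<And>i j. i < N \<Longrightarrow> j < N \<Longrightarrow> f i j = g i j"
  shows "fdet N f = fdet N g"
  unfolding fdet_def using assms by (intro arg_cong[of _ _ Determinant.det] eq_matI) auto

lemma fdet_leibniz:
  "fdet N f = (\<Sum>p\<in>{p. p permutes {0..<N}}. signof p * (\<Prod>i<N. f i (p i)))"
proof -
  have "(\<Prod>i = 0..<N. Matrix.mat N N (\<lambda>(i, j). f i j) $$ (i, p i)) = (\<Prod>i<N. f i (p i))"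
    if p: "p permutes {0..<N}" for p
  proof (rule prod.cong)
    fix i assume "i \<in> {..<N}"
    then show "Matrix.mat N N (\<lambda>(i, j). f i j) $$ (i, p i) = f i (p i)"
      using permutes_in_image[OF p, of i] by simp
  qed auto
  then show ?thesis
    unfolding fdet_def by (subst det_def'[of _ N]) (auto intro!: sum.cong)
qed

lemma fdet_transpose: "fdet N (\<lambda>i j. f j i) = fdet N f"
proof -
  have "Matrix.mat N N (\<lambda>(i, j). f j i) = transpose_mat (Matrix.mat N N (\<lambda>(i, j). f i j))"
    by (intro eq_matI) auto
  then show ?thesis
    unfolding fdet_def by (simp add: det_transpose[of _ N])
qed

lemma fdet_mult:
  "fdet N (\<lambda>i j. \<Sum>k<N. f i k * g k j) = fdet N f * fdet N g"
proof -
  have "Matrix.mat N N (\<lambda>(i, j). \<Sum>k<N. f i k * g k j) =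
    Matrix.mat N N (\<lambda>(i, j). f i j) * Matrix.mat N N (\<lambda>(i, j). g i j)"
    by (intro eq_matI) (auto simp: scalar_prod_def lessThan_atLeast0)
  then show ?thesis
    unfolding fdet_def by (simp add: det_mult[of _ N])
qed

lemma fdet_scale_rows: "fdet N (\<lambda>i j. a i * f i j) = (\<Prod>i<N. a i) * fdet N f"
  by (simp add: fdet_leibniz prod.distrib sum_distrib_left mult_ac)

lemma fdet_scale_cols: "fdet N (\<lambda>i j. a j * f i j) = (\<Prod>j<N. a j) * fdet N f"
  using fdet_scale_rows[of N a "\<lambda>i j. f j i"] fdet_transpose[of N f]
    fdet_transpose[of N "\<lambda>i j. a j * f i j"] by simp

lemma fdet_permute_cols:
  assumes "p permutes {0..<N}"
  shows "fdet N (\<lambda>i j. f i (p j)) = signof p * fdet N f"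
proof -
  have "fdet N (\<lambda>i j. f j (p i)) = signof p * fdet N (\<lambda>i j. f j i)"
  proof -
    have "Matrix.mat N N (\<lambda>(i, j). f j (p i)) =
      Matrix.mat N N (\<lambda>(i, j). Matrix.mat N N (\<lambda>(i, j). f j i) $$ (p i, j))"
    proof (rule eq_matI)
      fix i j
      assume "i < dim_row (Matrix.mat N N (\<lambda>(i, j). Matrix.mat N N (\<lambda>(i, j). f j i) $$ (p i, j)))"
        "j < dim_col (Matrix.mat N N (\<lambda>(i, j). Matrix.mat N N (\<lambda>(i, j). f j i) $$ (p i, j)))"
      then show "Matrix.mat N N (\<lambda>(i, j). f j (p i)) $$ (i, j) =
          Matrix.mat N N (\<lambda>(i, j). Matrix.mat N N (\<lambda>(i, j). f j i) $$ (p i, j)) $$ (i, j)"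
        using permutes_in_image[OF assms, of i] by simp
    qed auto
    then show ?thesis
      unfolding fdet_def by (simp add: det_permute_rows[OF _ assms])
  qed
  then show ?thesis
    by (simp add: fdet_transpose[of N f] fdet_transpose[of N "\<lambda>i j. f i (p j)"])
qed

lemma fdet_block:
  assumes "\<And>i j. i < p \<Longrightarrow> p \<le> j \<Longrightarrow> j < p + q \<Longrightarrow> f i j = 0"
  shows "fdet (p + q) f = fdet p f * fdet q (\<lambda>i j. f (p + i) (p + j))"
proof -
  have "Matrix.mat (p + q) (p + q) (\<lambda>(i, j). f i j) =
    four_block_mat (Matrix.mat p p (\<lambda>(i, j). f i j)) (0\<^sub>m p q)
      (Matrix.mat q p (\<lambda>(i, j). f (p + i) j)) (Matrix.mat q q (\<lambda>(i, j). f (p + i) (p + j)))"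
    using assms by (intro eq_matI) auto
  then show ?thesis
    unfolding fdet_def
    by (simp add: det_four_block_mat_upper_right_zero[of _ p _ q])
qed

lemma fdet_lower_triangular:
  assumes "\<And>i j. i < j \<Longrightarrow> j < N \<Longrightarrow> f i j = 0"
  shows "fdet N f = (\<Prod>i<N. f i i)"
  using assms
proof (induction N)
  case 0
  then show ?case by (simp add: fdet_leibniz)
next
  case (Suc N)
  have "fdet (N + 1) f = fdet N f * fdet 1 (\<lambda>i j. f (N + i) (N + j))"
    by (rule fdet_block) (use Suc.prems in auto)
  moreover have "fdet 1 g = g 0 0" for g :: "nat \<Rightarrow> nat \<Rightarrow> 'a"
    unfolding fdet_def by (subst det_single) auto
  ultimately show ?case using Suc by simp
qed

lemma tendsto_fdet:
  fixes f :: "'b \<Rightarrow> nat \<Rightarrow> nat \<Rightarrow> 'a :: real_normed_field"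
  assumes "\<And>i j. i < N \<Longrightarrow> j < N \<Longrightarrow> ((\<lambda>z. f z i j) \<longlongrightarrow> g i j) F"
  shows "((\<lambda>z. fdet N (f z)) \<longlongrightarrow> fdet N g) F"
  unfolding fdet_leibniz
proof (intro tendsto_sum tendsto_mult tendsto_const tendsto_prod)
  fix p i
  assume "p \<in> {p. p permutes {0..<N}}" "i \<in> {..<N}"
  then show "((\<lambda>z. f z i (p i)) \<longlongrightarrow> g i (p i)) F"
    using permutes_in_image[of p "{0..<N}" i] by (intro assms) auto
qed

section \<open>Permutations of the columns\<close>

text \<open>A cycle of length b - a + 1. Enlarging the reversal by one index, or the unshuffle by
  one pair, composes it with such a cycle, so both signs follow by induction.\<close>

definition cycle_down :: "nat \<Rightarrow> nat \<Rightarrow> nat \<Rightarrow> nat" where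
  "cycle_down a b j = (if j = a then b else if a < j \<and> j \<le> b then j - 1 else j)"

lemma cycle_down_Suc:
  "a \<le> b \<Longrightarrow> cycle_down a (Suc b) = Transposition.transpose b (Suc b) \<circ> cycle_down a b"
  by (rule ext) (auto simp: cycle_down_def Transposition.transpose_def)

lemma cycle_down_permutes_sign:
  assumes "a \<le> b"
  shows "cycle_down a b permutes {a..b} \<and> sign (cycle_down a b) = (-1) ^ (b - a)"
  using assms
proof (induction b rule: dec_induct)
  case base
  have "cycle_down a a = id" by (rule ext) (simp add: cycle_down_def)
  then show ?case by (simp only: permutes_id sign_id) simp
next
  case (step b)
  have perm: "cycle_down a b permutes {a..Suc b}"
    by (rule permutes_subset[OF conjunct1[OF step.IH]]) simp
  have tr: "Transposition.transpose b (Suc b) permutes {a..Suc b}"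
    using step.hyps by (intro permutes_swap_id) auto
  have "cycle_down a (Suc b) permutes {a..Suc b}"
    using permutes_compose[OF perm tr] step.hyps by (simp add: cycle_down_Suc)
  moreover have "sign (cycle_down a (Suc b)) = - sign (cycle_down a b)"
    using step.hyps permutes_imp_permutation[OF _ perm] permutes_imp_permutation[OF _ tr]
    by (simp add: cycle_down_Suc sign_compose sign_swap_id)
  ultimately show ?case using step.hyps conjunct2[OF step.IH] by (simp add: Suc_diff_le)
qed

definition reversal :: "nat \<Rightarrow> nat \<Rightarrow> nat" where
  "reversal N j = (if j < N then N - 1 - j else j)"

lemma reversal_permutes_sign:
  "reversal N permutes {0..<N} \<and> sign (reversal N) = (-1) ^ (N * (N - 1) div 2)"
proof (induction N)
  case 0
  have "reversal 0 = id" by (rule ext) (simp add: reversal_def)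
  then show ?case by (simp only: permutes_id sign_id) simp
next
  case (Suc N)
  have rev: "reversal (Suc N) = reversal N \<circ> cycle_down 0 N"
  proof
    fix j
    show "reversal (Suc N) j = (reversal N \<circ> cycle_down 0 N) j"
      by (cases "j = 0"; cases "j \<le> N") (simp_all add: reversal_def cycle_down_def)
  qed
  have 1: "reversal N permutes {0..<Suc N}"
    by (rule permutes_subset[OF conjunct1[OF Suc]]) simp
  have 2: "cycle_down 0 N permutes {0..<Suc N}"
    using cycle_down_permutes_sign[of 0 N] by (simp add: atLeastLessThanSuc_atLeastAtMost)
  have "Suc N * (Suc N - 1) = N * (N - 1) + 2 * N" by (cases N) auto
  then have "Suc N * (Suc N - 1) div 2 = N * (N - 1) div 2 + N" by simp
  moreover have "sign (reversal (Suc N)) = sign (reversal N) * sign (cycle_down 0 N)"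
    unfolding rev by (rule sign_compose) (use permutes_imp_permutation[OF _ 1] permutes_imp_permutation[OF _ 2] in auto)
  moreover have "reversal (Suc N) permutes {0..<Suc N}"
    unfolding rev by (rule permutes_compose[OF 2 1])
  ultimately show ?case
    using conjunct2[OF Suc] conjunct2[OF cycle_down_permutes_sign[of 0 N]] by (simp only: power_add) simp
qed

text \<open>Needed twice: the characters list their exponents in decreasing order, and the columns
  at the infinite arguments are expanded starting from the last one.\<close>

lemma fdet_reverse_cols:
  "fdet N (\<lambda>i j. f i (N - 1 - j)) = (-1) ^ (N * (N - 1) div 2) * fdet N f"
proof -
  have "fdet N (\<lambda>i j. f i (N - 1 - j)) = fdet N (\<lambda>i j. f i (reversal N j))"
    by (rule fdet_cong) (simp add: reversal_def)
  then show ?thesis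
    using reversal_permutes_sign[of N] by (simp add: fdet_permute_cols)
qed

text \<open>The inverse of the perfect shuffle: it collects the even columns in the first n
  positions and the odd ones in the next n. Being the identity beyond them, it extends to n + 1
  pairs by moving the fixed point 2 n to position n.\<close>

definition unshuffle :: "nat \<Rightarrow> nat \<Rightarrow> nat" where
  "unshuffle n j = (if j < n then 2 * j else if j < 2 * n then 2 * (j - n) + 1 else j)"

lemma unshuffle_permutes_sign:
  "unshuffle n permutes {0..<2 * n} \<and> sign (unshuffle n) = (-1) ^ (n * (n - 1) div 2)"
proof (induction n)
  case 0
  have "unshuffle 0 = id" by (rule ext) (simp add: unshuffle_def)
  then show ?case by (simp only: permutes_id sign_id) simp
next
  case (Suc n)
  have eq: "unshuffle (Suc n) = unshuffle n \<circ> cycle_down n (2 * n)"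
  proof
    fix j
    consider "j < n" | "j = n" | "n < j" "j \<le> 2 * n" | "j > 2 * n" by linarith
    then show "unshuffle (Suc n) j = (unshuffle n \<circ> cycle_down n (2 * n)) j"
      by cases (simp_all add: unshuffle_def cycle_down_def, linarith+)
  qed
  have 1: "unshuffle n permutes {0..<2 * Suc n}"
    by (rule permutes_subset[OF conjunct1[OF Suc]]) simp
  have 2: "cycle_down n (2 * n) permutes {0..<2 * Suc n}"
    by (rule permutes_subset[OF conjunct1[OF cycle_down_permutes_sign[of n "2 * n"]]]) auto
  have "Suc n * (Suc n - 1) = n * (n - 1) + 2 * n" by (cases n) auto
  then have "Suc n * (Suc n - 1) div 2 = n * (n - 1) div 2 + n" by simp
  moreover have "sign (unshuffle (Suc n)) = sign (unshuffle n) * sign (cycle_down n (2 * n))"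
    unfolding eq by (rule sign_compose) (use permutes_imp_permutation[OF _ 1] permutes_imp_permutation[OF _ 2] in auto)
  moreover have "unshuffle (Suc n) permutes {0..<2 * Suc n}"
    unfolding eq by (rule permutes_compose[OF 2 1])
  ultimately show ?case
    using conjunct2[OF Suc] conjunct2[OF cycle_down_permutes_sign[of n "2 * n"]] by (simp only: power_add) simp
qed

lemma fdet_unshuffle_cols:
  "fdet (2 * n) (\<lambda>i j. if j < n then f i (2 * j) else f i (2 * (j - n) + 1)) =
    (-1) ^ (n * (n - 1) div 2) * fdet (2 * n) f"
proof -
  have "fdet (2 * n) (\<lambda>i j. if j < n then f i (2 * j) else f i (2 * (j - n) + 1)) =
      fdet (2 * n) (\<lambda>i j. f i (unshuffle n j))"
    by (rule fdet_cong) (auto simp: unshuffle_def)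
  then show ?thesis
    using unshuffle_permutes_sign[of n] by (simp add: fdet_permute_cols)
qed

section \<open>Unitriangular changes of basis\<close>

text \<open>The span of the columns f 0, ..., f (c - 1). One set of coefficients serves every row
  index, not only the rows of a particular matrix, so relations fed into it have to hold for all
  i.\<close>

definition lspan :: "nat \<Rightarrow> (nat \<Rightarrow> nat \<Rightarrow> 'a :: field) \<Rightarrow> (nat \<Rightarrow> 'a) \<Rightarrow> bool" where
  "lspan c f v \<longleftrightarrow> (\<exists>a. \<forall>i. v i = (\<Sum>d<c. a d * f d i))"

lemma lspan_add: "lspan c f v \<Longrightarrow> lspan c f w \<Longrightarrow> lspan c f (\<lambda>i. v i + w i)"
proof -
  assume "lspan c f v" "lspan c f w"
  then obtain a b where "\<And>i. v i = (\<Sum>d<c. a d * f d i)" "\<And>i. w i = (\<Sum>d<c. b d * f d i)"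
    unfolding lspan_def by blast
  then show ?thesis
    unfolding lspan_def by (intro exI[of _ "\<lambda>d. a d + b d"]) (simp add: sum.distrib ring_distribs)
qed

lemma lspan_scale: "lspan c f v \<Longrightarrow> lspan c f (\<lambda>i. k * v i)"
proof -
  assume "lspan c f v"
  then obtain a where "\<And>i. v i = (\<Sum>d<c. a d * f d i)"
    unfolding lspan_def by blast
  then show ?thesis
    unfolding lspan_def by (intro exI[of _ "\<lambda>d. k * a d"]) (simp add: sum_distrib_left mult_ac)
qed

lemma lspan_zero: "lspan c f (\<lambda>i. 0)"
  unfolding lspan_def by (intro exI[of _ "\<lambda>d. 0"]) simp

lemma lspan_base: "d < c \<Longrightarrow> lspan c f (f d)"
  unfolding lspan_def by (intro exI[of _ "\<lambda>e. if e = d then 1 else 0"])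
    (simp add: if_distrib[of "\<lambda>x. x * _"] cong: if_cong)

lemma lspan_sum:
  "finite A \<Longrightarrow> (\<And>x. x \<in> A \<Longrightarrow> lspan c f (v x)) \<Longrightarrow> lspan c f (\<lambda>i. \<Sum>x\<in>A. v x i)"
  by (induction A rule: finite_induct) (auto intro: lspan_zero lspan_add)

lemma lspan_mono: "lspan c f v \<Longrightarrow> c \<le> c' \<Longrightarrow> lspan c' f v"
proof -
  assume "lspan c f v" and le: "c \<le> c'"
  then obtain a where a: "\<And>i. v i = (\<Sum>d<c. a d * f d i)"
    unfolding lspan_def by blast
  have "lspan c' f (\<lambda>i. \<Sum>d<c. a d * f d i)"
    using le by (intro lspan_sum lspan_scale lspan_base) auto
  then show ?thesis using a by (simp add: lspan_def)
qed

lemma lspan_shift: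
  assumes "lspan c f v" and f: "\<And>c i. f (c + s) i = H i * f c i"
  shows "lspan (c + s) f (\<lambda>i. H i * v i)"
proof -
  obtain a where a: "\<And>i. v i = (\<Sum>d<c. a d * f d i)"
    using assms unfolding lspan_def by blast
  have "lspan (c + s) f (\<lambda>i. \<Sum>d<c. a d * f (d + s) i)"
    by (intro lspan_sum lspan_scale lspan_base) auto
  then show ?thesis
    by (simp add: a f sum_distrib_left mult_ac)
qed

text \<open>The change of basis is triangular with ones on the diagonal, so corrections by earlier
  columns do not affect the determinant.\<close>

lemma fdet_unitriangular:
  assumes "\<And>c. c < N \<Longrightarrow> lspan c f (\<lambda>i. g c i - f c i)"
  shows "fdet N (\<lambda>i c. g c i) = fdet N (\<lambda>i c. f c i)"
proof -
  have "\<forall>c. \<exists>a. c < N \<longrightarrow> (\<forall>i. g c i - f c i = (\<Sum>d<c. a d * f d i))"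
    using assms unfolding lspan_def by blast
  then obtain a where a: "\<And>c i. c < N \<Longrightarrow> g c i - f c i = (\<Sum>d<c. a c d * f d i)"
    by metis
  define u where "u c d = (if d < c then a c d else if d = c then 1 else 0)" for c d
  have "g c i = (\<Sum>d<N. u c d * f d i)" if "c < N" for c i
  proof -
    have "(\<Sum>d<N. u c d * f d i) = (\<Sum>d<Suc c. u c d * f d i)"
      using that by (intro sum.mono_neutral_right) (auto simp: u_def)
    also have "\<dots> = (\<Sum>d<c. a c d * f d i) + f c i"
      by (simp add: u_def)
    finally show ?thesis using a[OF that, of i] by (simp add: algebra_simps)
  qed
  then have "fdet N (\<lambda>c i. g c i) = fdet N (\<lambda>c i. \<Sum>d<N. u c d * f d i)"
    by (intro fdet_cong) auto
  also have "\<dots> = fdet N u * fdet N f"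
    by (rule fdet_mult)
  also have "fdet N u = 1"
    by (subst fdet_lower_triangular) (auto simp: u_def)
  finally show ?thesis by (simp add: fdet_transpose[of N f] fdet_transpose[of N g])
qed

text \<open>The family f is exactly multiplicative with period s, while g follows the same rule only
  up to earlier columns of g itself. By strong induction those earlier columns lie in the span of
  earlier f, and multiplication by H shifts the remaining error by s places, so it stays below
  column c.\<close>

lemma fdet_recurrence:
  assumes s: "s > 0"
    and f: "\<And>c i. f (c + s) i = H i * f c i"
    and base: "\<And>c. c < s \<Longrightarrow> lspan c f (\<lambda>i. g c i - f c i)"
    and step: "\<And>c. lspan (c + s) g (\<lambda>i. g (c + s) i - H i * g c i)"
  shows "fdet N (\<lambda>i c. g c i) = fdet N (\<lambda>i c. f c i)"
proof (rule fdet_unitriangular)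
  fix c
  show "lspan c f (\<lambda>i. g c i - f c i)"
  proof (induction c rule: less_induct)
    case (less c)
    show ?case
    proof (cases "c < s")
      case True
      then show ?thesis by (rule base)
    next
      case False
      define d where "d = c - s"
      have d: "c = d + s" "d < c" using False s by (auto simp: d_def)
      have g: "lspan c f (g e)" if "e < c" for e
      proof -
        have "lspan c f (\<lambda>i. (g e i - f e i) + f e i)"
          using that by (intro lspan_add[OF lspan_mono[OF less.IH[OF that]] lspan_base]) auto
        then show ?thesis by simp
      qed
      obtain a where a: "\<And>i. g c i - H i * g d i = (\<Sum>e<c. a e * g e i)"
        using step[of d] unfolding lspan_def d by blast
      have "lspan c f (\<lambda>i. (\<Sum>e<c. a e * g e i) + H i * (g d i - f d i))"
      proof (rule lspan_add)
        show "lspan c f (\<lambda>i. \<Sum>e<c. a e * g e i)"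
          by (rule lspan_sum) (auto intro: lspan_scale g)
        show "lspan c f (\<lambda>i. H i * (g d i - f d i))"
          using lspan_shift[of d f _ s H, OF less.IH[OF d(2)] f] d(1) by simp
      qed
      also have "(\<lambda>i. (\<Sum>e<c. a e * g e i) + H i * (g d i - f d i)) = (\<lambda>i. g c i - f c i)"
        unfolding a[symmetric] by (rule ext) (simp add: d(1) f algebra_simps)
      finally show ?thesis .
    qed
  qed
qed

section \<open>Splitting and reindexing finite sums and products\<close>

lemma sum_lessThan_add:
  fixes f :: "nat \<Rightarrow> 'a :: comm_monoid_add"
  shows "(\<Sum>i<m + k. f i) = (\<Sum>i<m. f i) + (\<Sum>i<k. f (m + i))"
  by (induction k) (simp_all add: ac_simps)

lemma prod_lessThan_add:
  fixes f :: "nat \<Rightarrow> 'a :: comm_monoid_mult"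
  shows "(\<Prod>i<m + k. f i) = (\<Prod>i<m. f i) * (\<Prod>i<k. f (m + i))"
  by (induction k) (simp_all add: ac_simps)

lemma prod_pairs_eq:
  fixes g :: "nat \<Rightarrow> nat \<Rightarrow> 'a :: comm_monoid_mult"
  shows "(\<Prod>i=1..N. \<Prod>j=i+1..N. g i j) = (\<Prod>j<N. \<Prod>i<j. g (Suc i) (Suc j))"
proof (induction N)
  case (Suc N)
  have "(\<Prod>i=1..Suc N. \<Prod>j=i+1..Suc N. g i j) = (\<Prod>i=1..N. \<Prod>j=i+1..Suc N. g i j)"
    by simp
  also have "\<dots> = (\<Prod>i=1..N. (\<Prod>j=i+1..N. g i j) * g i (Suc N))"
    by (intro prod.cong) auto
  also have "\<dots> = (\<Prod>j<N. \<Prod>i<j. g (Suc i) (Suc j)) * (\<Prod>i=1..N. g i (Suc N))"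
    by (simp only: prod.distrib Suc)
  also have "(\<Prod>i=1..N. g i (Suc N)) = (\<Prod>i<N. g (Suc i) (Suc N))"
    by (simp add: prod.atLeast1_atMost_eq)
  finally show ?case by simp
qed simp

section \<open>Vandermonde and Cauchy type determinants\<close>

definition vprod :: "nat \<Rightarrow> (nat \<Rightarrow> 'a :: field) \<Rightarrow> 'a" where
  "vprod N w = (\<Prod>i<N. \<Prod>j<i. w i - w j)"

lemma vprod_cong: "(\<And>i. i < N \<Longrightarrow> v i = w i) \<Longrightarrow> vprod N v = vprod N w"
  unfolding vprod_def by (intro prod.cong) auto

lemma vprod_nonzero_iff: "vprod N w \<noteq> 0 \<longleftrightarrow> inj_on w {..<N}"
proof
  assume nz: "vprod N w \<noteq> 0"
  have "w j \<noteq> w i" if "j < i" "i < N" for i j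
  proof -
    have "(\<Prod>j<i. w i - w j) \<noteq> 0" using nz that by (simp add: vprod_def)
    then show ?thesis using that by (metis eq_iff_diff_eq_0 finite_lessThan lessThan_iff prod_zero_iff)
  qed
  then show "inj_on w {..<N}" by (intro linorder_inj_onI') auto
qed (force simp: vprod_def inj_on_def)

text \<open>The Newton basis with nodes X 0, X 1, ... is monic, hence a unitriangular change of the
  monomials, and its matrix at the same nodes is triangular.\<close>

lemma vandermonde: "fdet N (\<lambda>i c. X i ^ c) = vprod N X"
proof -
  have "fdet N (\<lambda>i c. \<Prod>l<c. X i - X l) = fdet N (\<lambda>i c. X i ^ c)"
  proof (rule fdet_recurrence[of 1 "\<lambda>c i. X i ^ c" X "\<lambda>c i. \<Prod>l<c. X i - X l"])
    fix c :: nat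
    show "lspan c (\<lambda>c i. X i ^ c) (\<lambda>i. (\<Prod>l<c. X i - X l) - X i ^ c)" if "c < 1"
      using that by (simp add: lspan_zero)
    let ?g = "\<lambda>c i. \<Prod>l<c. X i - X l"
    have "lspan (c + 1) ?g (\<lambda>i. (- X c) * ?g c i)"
      by (rule lspan_scale[OF lspan_base]) simp
    then show "lspan (c + 1) ?g (\<lambda>i. ?g (c + 1) i - X i * ?g c i)"
      by (simp add: algebra_simps)
  qed auto
  moreover have "fdet N (\<lambda>i c. \<Prod>l<c. X i - X l) = vprod N X"
    unfolding vprod_def by (rule fdet_lower_triangular) auto
  ultimately show ?thesis by simp
qed

text \<open>Both sides are polynomials in y of degree below n that agree at the n nodes.\<close>

lemma lagrange_interpolation_power:
  fixes X :: "nat \<Rightarrow> 'a :: field"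
  assumes "inj_on X {..<n}" "m < n"
  shows "(\<Sum>i<n. (\<Prod>k\<in>{..<n} - {i}. (y - X k) / (X i - X k)) * X i ^ m) = y ^ m"
proof -
  define l where "l i = smult (1 / (\<Prod>k\<in>{..<n} - {i}. X i - X k)) (\<Prod>k\<in>{..<n} - {i}. [:- X k, 1:])" for i
  have poly_l: "poly (l i) x = (\<Prod>k\<in>{..<n} - {i}. (x - X k) / (X i - X k))" for i x
    by (simp add: l_def poly_prod prod_dividef)
  have deg_l: "degree (l i) \<le> n - 1" if "i < n" for i
  proof -
    have "degree (\<Prod>k\<in>{..<n} - {i}. [:- X k, 1:]) \<le> (\<Sum>k\<in>{..<n} - {i}. degree [:- X k, 1:])"
      using degree_prod_sum_le by (metis (no_types, lifting) finite_Diff finite_lessThan comp_apply sum.cong)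
    then show ?thesis using that by (auto simp: l_def card_Diff_singleton intro: order.trans[OF degree_smult_le])
  qed
  define p where "p = (\<Sum>i<n. smult (X i ^ m) (l i))"
  have deg_p: "degree p \<le> n - 1"
    unfolding p_def by (rule degree_sum_le) (use deg_l in \<open>auto intro: order.trans[OF degree_smult_le]\<close>)
  have "p = monom 1 m"
  proof (rule poly_eqI_degree[of "X ` {..<n}"])
    fix x assume "x \<in> X ` {..<n}"
    then obtain j where j: "j < n" "x = X j" by auto
    have "poly (l i) (X j) = (if i = j then 1 else 0)" if "i < n" for i
    proof (cases "i = j")
      case True
      have "(X i - X k) / (X i - X k) = 1" if "k \<in> {..<n} - {i}" for k
        using that \<open>i < n\<close> assms(1) by (auto simp: inj_on_def)
      then show ?thesis using True by (simp add: poly_l)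
    next
      case False
      then show ?thesis using j that by (auto simp: poly_l intro!: prod_zero)
    qed
    then have "(\<Sum>i<n. X i ^ m * poly (l i) (X j)) = (\<Sum>i<n. if i = j then X i ^ m else 0)"
      by (intro sum.cong) auto
    then show "poly p x = poly (monom 1 m) x"
      using j by (simp add: p_def poly_sum poly_monom)
  qed (use assms deg_p in \<open>auto simp: card_image degree_monom_eq\<close>)
  then have "poly p y = y ^ m" by (simp add: poly_monom)
  then show ?thesis by (simp add: p_def poly_sum poly_l mult_ac)
qed

text \<open>Each unordered pair contributes its difference twice, with opposite signs. This
  evaluates the product of all Lagrange denominators.\<close>

lemma prod_differences:
  "(\<Prod>j<n. \<Prod>k\<in>{..<n} - {j}. Y j - Y k) = (-1) ^ (n * (n - 1) div 2) * (vprod n Y)\<^sup>2"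
proof (induction n)
  case 0
  then show ?case by (simp add: vprod_def)
next
  case (Suc n)
  have "(\<Prod>j<Suc n. \<Prod>k\<in>{..<Suc n} - {j}. Y j - Y k) =
    (\<Prod>j<n. (\<Prod>k\<in>{..<n} - {j}. Y j - Y k) * (Y j - Y n)) * (\<Prod>k<n. Y n - Y k)"
  proof -
    have "(\<Prod>k\<in>{..<Suc n} - {j}. Y j - Y k) = (\<Prod>k\<in>{..<n} - {j}. Y j - Y k) * (Y j - Y n)"
      if "j < n" for j
    proof -
      have "{..<Suc n} - {j} = insert n ({..<n} - {j})" using that by auto
      then show ?thesis by (simp add: mult_ac)
    qed
    moreover have "{..<Suc n} - {n} = {..<n}" by auto
    ultimately show ?thesis by simp
  qed
  also have "(\<Prod>j<n. (\<Prod>k\<in>{..<n} - {j}. Y j - Y k) * (Y j - Y n)) =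
    (-1) ^ (n * (n - 1) div 2) * (vprod n Y)\<^sup>2 * (\<Prod>j<n. Y j - Y n)"
    by (simp add: prod.distrib Suc)
  also have "(\<Prod>j<n. Y j - Y n) = (-1) ^ n * (\<Prod>j<n. Y n - Y j)"
  proof -
    have "(\<Prod>j<n. Y j - Y n) = (\<Prod>j<n. (-1) * (Y n - Y j))" by (rule prod.cong) auto
    then show ?thesis by (simp only: prod.distrib) simp
  qed
  finally have *: "(\<Prod>j<Suc n. \<Prod>k\<in>{..<Suc n} - {j}. Y j - Y k) =
    (-1) ^ (n * (n - 1) div 2) * (-1) ^ n * ((vprod n Y)\<^sup>2 * (\<Prod>j<n. Y n - Y j)\<^sup>2)"
    by (simp add: power2_eq_square mult_ac)
  have "Suc n * (Suc n - 1) = n * (n - 1) + 2 * n" by (cases n) auto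
  then have "Suc n * (Suc n - 1) div 2 = n * (n - 1) div 2 + n" by simp
  then show ?case
    unfolding * by (simp add: vprod_def power_add power_mult_distrib)
qed

text \<open>
  Lagrange interpolation at the last \<open>n\<close> nodes clears the odd-numbered entries of the first
  \<open>n\<close> rows.
\<close>

lemma fdet_two_families:
  fixes h a b :: "nat \<Rightarrow> 'a :: field"
  assumes inj: "inj_on (\<lambda>j. h (n + j)) {..<n}"
    and ne: "\<And>i j. i < n \<Longrightarrow> j < n \<Longrightarrow> h i \<noteq> h (n + j)"
    and a: "\<And>j. j < n \<Longrightarrow> a (n + j) \<noteq> 0"
  shows "fdet (2 * n) (\<lambda>i c. (if even c then b i else a i) * h i ^ (c div 2)) =
    (\<Prod>i<n. \<Prod>j<n. h i - h (n + j)) *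
    fdet n (\<lambda>i j. (a i * b (n + j) - a (n + j) * b i) / (h (n + j) - h i))"
proof -
  define Y where "Y j = h (n + j)" for j
  define L where "L i j = (\<Prod>k\<in>{..<n} - {j}. (h i - Y k) / (Y j - Y k))" for i j
  define U where "U i c = (if c < n then b i * h i ^ c else a i * h i ^ (c - n))" for i c
  \<comment> \<open>The columns of \<open>U\<close> are sorted so that the family a h^k comes last.
    Row r of the upper half loses the last rows weighted by a_r L_rj / a_(n+j); by interpolation the
    entries a_r h_r^k cancel exactly.\<close>
  define T where "T r s = (if r < n \<and> n \<le> s then - a r * L r (s - n) / a s
    else if r = s then 1 else 0)" for r s
  \<comment> \<open>Writing b_r h_r^c as its own interpolant too, each remaining entry of the upper
    half becomes a sum over the nodes, and the upper left block factors as \<open>K\<close> times a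
    Vandermonde matrix.\<close>
  define K where "K i j = L i j * (b i - a i * b (n + j) / a (n + j))" for i j
  define W where "W r c = (if r < n then if c < n then \<Sum>j<n. K r j * Y j ^ c else 0
    else U r c)" for r c
  define sgn :: 'a where "sgn = (-1) ^ (n * (n - 1) div 2)"
  have sgn2: "sgn * sgn = 1"
    by (simp add: sgn_def flip: power_add)
  have inj_Y: "inj_on Y {..<n}" using inj by (simp add: Y_def inj_on_def)
  have lag: "(\<Sum>j<n. L i j * Y j ^ m) = h i ^ m" if "m < n" for i m
    unfolding L_def using lagrange_interpolation_power[OF inj_Y that] .
  have "sgn * fdet (2 * n) (\<lambda>i c. (if even c then b i else a i) * h i ^ (c div 2)) = fdet (2 * n) U"
    unfolding sgn_def fdet_unshuffle_cols[symmetric] by (rule fdet_cong) (auto simp: U_def)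
  also have "fdet (2 * n) U = fdet (2 * n) T * fdet (2 * n) U"
  proof -
    have "fdet (2 * n) (\<lambda>i j. T j i) = 1"
      by (subst fdet_lower_triangular) (auto simp: T_def intro!: prod.neutral)
    then show ?thesis by (simp add: fdet_transpose[of _ T])
  qed
  also have "\<dots> = fdet (2 * n) (\<lambda>r c. \<Sum>s<2 * n. T r s * U s c)"
    by (rule fdet_mult[symmetric])
  also have "\<dots> = fdet (2 * n) W"
  proof (rule fdet_cong)
    fix r c assume rc: "r < 2 * n" "c < 2 * n"
    have sum: "(\<Sum>s<2 * n. T r s * U s c) = (\<Sum>s<n. T r s * U s c) + (\<Sum>s<n. T r (n + s) * U (n + s) c)"
      using sum_lessThan_add[of "\<lambda>s. T r s * U s c" n n] by (simp add: mult_2)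
    show "(\<Sum>s<2 * n. T r s * U s c) = W r c"
    proof (cases "r < n")
      case True
      have 1: "(\<Sum>s<n. T r s * U s c) = U r c"
      proof -
        have "(\<Sum>s<n. T r s * U s c) = (\<Sum>s<n. if s = r then U s c else 0)"
          by (rule sum.cong) (auto simp: T_def)
        then show ?thesis using True by simp
      qed
      show ?thesis
      proof (cases "c < n")
        case c: True
        have "U r c = (\<Sum>j<n. L r j * Y j ^ c * b r)"
          using lag[OF c, of r] c by (simp add: U_def flip: sum_distrib_right)
        moreover have "(\<Sum>s<n. T r (n + s) * U (n + s) c) =
          (\<Sum>j<n. - (L r j * Y j ^ c * (a r * b (n + j) / a (n + j))))"
          using True c by (intro sum.cong) (auto simp: T_def U_def Y_def)
        ultimately show ?thesis
          using True c unfolding sum 1 W_def K_def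
          by (simp add: sum_negf sum_subtractf[symmetric] algebra_simps)
      next
        case False
        have "(\<Sum>s<n. T r (n + s) * U (n + s) c) = (\<Sum>j<n. - a r * (L r j * Y j ^ (c - n)))"
          using True False a by (intro sum.cong) (auto simp: T_def U_def Y_def)
        also have "\<dots> = - a r * h r ^ (c - n)"
          using lag[of "c - n" r] rc False by (simp only: sum_distrib_left[symmetric])
        finally show ?thesis
          using True False unfolding sum 1 W_def by (simp add: U_def)
      qed
    next
      case False
      have "(\<Sum>s<2 * n. T r s * U s c) = (\<Sum>s<2 * n. if s = r then U s c else 0)"
        using False by (intro sum.cong) (auto simp: T_def)
      then show ?thesis using False rc by (simp add: W_def)
    qed
  qed
  also have "\<dots> = fdet n W * fdet n (\<lambda>i j. W (n + i) (n + j))"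
    using fdet_block[of n n W] by (simp add: W_def mult_2)
  also have "fdet n W = fdet n K * fdet n (\<lambda>j c. Y j ^ c)"
    unfolding fdet_mult[symmetric] by (rule fdet_cong) (simp add: W_def)
  also have "fdet n (\<lambda>i j. W (n + i) (n + j)) = fdet n (\<lambda>i j. a (n + i) * Y i ^ j)"
    by (rule fdet_cong) (simp add: W_def U_def Y_def)
  also have "\<dots> = (\<Prod>i<n. a (n + i)) * vprod n Y"
    by (simp add: fdet_scale_rows vandermonde)
  also have "fdet n (\<lambda>j c. Y j ^ c) = vprod n Y"
    by (rule vandermonde)
  \<comment> \<open>In L_ij the missing factor h_i - Y_j is multiplied in and divided out, so that
    everything except the Cauchy-like kernel depends on the row alone or on the column
    alone.\<close>
  also have "fdet n K = fdet n (\<lambda>i j. (\<Prod>k<n. h i - Y k) *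
     ((1 / a (n + j) / (\<Prod>k\<in>{..<n} - {j}. Y j - Y k)) *
       ((a i * b (n + j) - a (n + j) * b i) / (h (n + j) - h i))))"
  proof (rule fdet_cong)
    fix i j assume ij: "i < n" "j < n"
    have "(\<Prod>k<n. h i - Y k) = (h i - Y j) * (\<Prod>k\<in>{..<n} - {j}. h i - Y k)"
      using ij by (intro prod.remove) auto
    moreover have "h i - Y j \<noteq> 0" "a (n + j) \<noteq> 0" using ne a ij by (auto simp: Y_def)
    moreover have "(\<Prod>k\<in>{..<n} - {j}. Y j - Y k) \<noteq> 0"
      using inj_Y ij by (auto simp: inj_on_def)
    ultimately show "K i j = (\<Prod>k<n. h i - Y k) *
     ((1 / a (n + j) / (\<Prod>k\<in>{..<n} - {j}. Y j - Y k)) *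
       ((a i * b (n + j) - a (n + j) * b i) / (h (n + j) - h i)))"
      unfolding K_def L_def Y_def[of j, symmetric] prod_dividef
      by (simp add: divide_simps) (simp add: algebra_simps)
  qed
  also have "\<dots> = (\<Prod>i<n. \<Prod>k<n. h i - Y k) * ((\<Prod>j<n. 1 / a (n + j) / (\<Prod>k\<in>{..<n} - {j}. Y j - Y k)) *
      fdet n (\<lambda>i j. (a i * b (n + j) - a (n + j) * b i) / (h (n + j) - h i)))"
    by (simp only: fdet_scale_rows fdet_scale_cols)
  \<comment> \<open>The Lagrange denominators give the squared Vandermonde product, which cancels
    the two Vandermonde factors of the blocks; their sign cancels the sign of the unshuffle.\<close>
  also have "(\<Prod>j<n. 1 / a (n + j) / (\<Prod>k\<in>{..<n} - {j}. Y j - Y k)) =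
      1 / (\<Prod>j<n. a (n + j)) / (sgn * (vprod n Y)\<^sup>2)"
    by (simp add: prod_dividef prod.distrib prod_differences sgn_def)
  finally have "sgn * fdet (2 * n) (\<lambda>i c. (if even c then b i else a i) * h i ^ (c div 2)) =
    (\<Prod>i<n. \<Prod>k<n. h i - Y k) * (1 / (\<Prod>j<n. a (n + j)) / (sgn * (vprod n Y)\<^sup>2) *
      fdet n (\<lambda>i j. (a i * b (n + j) - a (n + j) * b i) / (h (n + j) - h i))) *
    vprod n Y * ((\<Prod>i<n. a (n + i)) * vprod n Y)" .
  moreover have "vprod n Y \<noteq> 0" "(\<Prod>j<n. a (n + j)) \<noteq> 0"
    using inj_Y a by (auto simp: vprod_nonzero_iff)
  moreover have "x = p * e"
    if "sgn * x = p * (1 / q / (sgn * v\<^sup>2) * e) * v * (q * v)" "v \<noteq> 0" "q \<noteq> 0" for x p q v e :: 'a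
  proof -
    have "sgn \<noteq> 0" using sgn2 by auto
    then have "p * (1 / q / (sgn * v\<^sup>2) * e) * v * (q * v) = p * e / sgn"
      using that by (simp add: field_simps power2_eq_square)
    then have "sgn * x * sgn = p * e" using that \<open>sgn \<noteq> 0\<close> by simp
    then show ?thesis using sgn2 by (simp add: mult_ac flip: mult.assoc)
  qed
  ultimately show ?thesis unfolding Y_def[symmetric] by blast
qed

section \<open>Alternants in the functions 1, r, h, r h, h^2, ..\<close>

lemma fdet_last_row_unit:
  assumes "\<And>j. j < n \<Longrightarrow> f n j = 0"
  shows "fdet (Suc n) f = fdet n f * f n n"
proof -
  have "fdet (n + 1) (\<lambda>i j. f j i) = fdet n (\<lambda>i j. f j i) * fdet 1 (\<lambda>i j. f (n + j) (n + i))"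
    by (rule fdet_block) (use assms in \<open>auto simp: less_Suc_eq\<close>)
  moreover have "fdet 1 (\<lambda>i j. f (n + j) (n + i)) = f n n"
    by (subst fdet_lower_triangular) auto
  ultimately show ?thesis by (simp add: fdet_transpose[of _ f])
qed

text \<open>The common shape of three determinants: the alternant behind S_n, with r = R/Q and h =
  P/Q, and the numerators of the two characters, with h equal to t^3 + t^-3 or u^3 + u^-3.\<close>

definition alt_det :: "nat \<Rightarrow> (nat \<Rightarrow> 'a :: field) \<Rightarrow> (nat \<Rightarrow> 'a) \<Rightarrow> 'a" where
  "alt_det N r h = fdet N (\<lambda>i c. r i ^ (c mod 2) * h i ^ (c div 2))"

lemma alt_det_cong:
  "(\<And>i. i < N \<Longrightarrow> r i = r' i) \<Longrightarrow> (\<And>i. i < N \<Longrightarrow> h i = h' i) \<Longrightarrow> alt_det N r h = alt_det N r' h'"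
  unfolding alt_det_def by (rule fdet_cong) auto

text \<open>Since r enters with exponent at most one, both translations only add multiples of
  earlier columns.\<close>

lemma alt_det_translate:
  "alt_det N (\<lambda>i. r i + \<alpha>) (\<lambda>i. h i + \<beta>) = alt_det N r h"
  unfolding alt_det_def
proof (rule fdet_recurrence[of 2 "\<lambda>c i. r i ^ (c mod 2) * h i ^ (c div 2)" h
      "\<lambda>c i. (r i + \<alpha>) ^ (c mod 2) * (h i + \<beta>) ^ (c div 2)"])
  let ?f = "\<lambda>c i. r i ^ (c mod 2) * h i ^ (c div 2)"
  let ?g = "\<lambda>c i. (r i + \<alpha>) ^ (c mod 2) * (h i + \<beta>) ^ (c div 2)"
  fix c :: nat
  show "lspan c ?f (\<lambda>i. ?g c i - ?f c i)" if "c < 2"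
  proof (cases "c = 0")
    case True
    then show ?thesis by (simp add: lspan_zero)
  next
    case False
    then have "c = 1" using that by simp
    moreover have "lspan 1 ?f (\<lambda>i. \<alpha> * ?f 0 i)"
      by (rule lspan_scale[OF lspan_base]) simp
    ultimately show ?thesis by simp
  qed
  have "lspan (c + 2) ?g (\<lambda>i. \<beta> * ?g c i)"
    by (rule lspan_scale[OF lspan_base]) simp
  then show "lspan (c + 2) ?g (\<lambda>i. ?g (c + 2) i - h i * ?g c i)"
    by (simp add: algebra_simps)
qed auto

lemma alt_det_scale:
  "alt_det N (\<lambda>i. \<alpha> * r i) (\<lambda>i. \<beta> * h i) = (\<Prod>c<N. \<alpha> ^ (c mod 2) * \<beta> ^ (c div 2)) * alt_det N r h"
  unfolding alt_det_def fdet_scale_cols[symmetric]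
  by (rule fdet_cong) (simp add: power_mult_distrib mult_ac)

text \<open>Translating r and h to vanish at the last node makes the last row (1, 0, ..., 0).
  Without that row and the column of ones, the columns form the two families b a^k and a a^k, and
  interpolation in h applies.\<close>

lemma alt_det_odd:
  fixes h r :: "nat \<Rightarrow> 'a :: field"
  assumes inj: "inj_on h {..<2 * n + 1}"
  shows "alt_det (2 * n + 1) r h =
    (\<Prod>i<n. \<Prod>j<n. h i - h (n + j)) *
    fdet n (\<lambda>i j. ((h i - h (2 * n)) * (r (n + j) - r (2 * n)) - (h (n + j) - h (2 * n)) * (r i - r (2 * n)))
      / (h (n + j) - h i))"
proof -
  define a where "a i = h i - h (2 * n)" for i
  define b where "b i = r i - r (2 * n)" for i
  define g where "g c i = b i ^ (c mod 2) * a i ^ (c div 2)" for c i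
  define f where "f i j = (if j < 2 * n then g (Suc j) i else g 0 i)" for i j
  have "alt_det (2 * n + 1) r h = alt_det (2 * n + 1) b a"
    using alt_det_translate[of "2 * n + 1" r "- r (2 * n)" h "- h (2 * n)"] by (simp add: a_def[abs_def] b_def[abs_def])
  also have "\<dots> = fdet (2 * n + 1) (\<lambda>i c. f i (cycle_down 0 (2 * n) c))"
    unfolding alt_det_def by (rule fdet_cong) (auto simp: f_def g_def cycle_down_def)
  \<comment> \<open>The constant column moves past 2 n others, an even permutation.\<close>
  also have "\<dots> = fdet (2 * n + 1) f"
  proof -
    have "cycle_down 0 (2 * n) permutes {0..<2 * n + 1}"
      by (rule permutes_subset[OF conjunct1[OF cycle_down_permutes_sign[of 0 "2 * n"]]]) auto
    then have "fdet (2 * n + 1) (\<lambda>i c. f i (cycle_down 0 (2 * n) c)) =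
        of_int (sign (cycle_down 0 (2 * n))) * fdet (2 * n + 1) f"
      by (rule fdet_permute_cols)
    then show ?thesis
      using conjunct2[OF cycle_down_permutes_sign[of 0 "2 * n"]] by simp
  qed
  also have "\<dots> = fdet (2 * n) f"
  proof -
    have "g (Suc j) (2 * n) = 0" for j
    proof (cases "even j")
      case True
      then have "Suc j mod 2 = 1" by presburger
      then show ?thesis by (simp add: g_def b_def)
    next
      case False
      then have "Suc j div 2 \<noteq> 0" by presburger
      then show ?thesis by (simp add: g_def a_def)
    qed
    then have "fdet (Suc (2 * n)) f = fdet (2 * n) f * f (2 * n) (2 * n)"
      by (intro fdet_last_row_unit) (simp add: f_def)
    then show ?thesis by (simp add: f_def g_def)
  qed
  also have "\<dots> = fdet (2 * n) (\<lambda>i c. (if even c then b i else a i) * a i ^ (c div 2))"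
  proof (rule fdet_cong)
    fix i c assume "c < 2 * n"
    show "f i c = (if even c then b i else a i) * a i ^ (c div 2)"
    proof (cases "even c")
      case True
      then have "Suc c mod 2 = 1" "Suc c div 2 = c div 2" by presburger+
      then show ?thesis using \<open>c < 2 * n\<close> True by (simp add: f_def g_def)
    next
      case False
      then have "Suc c mod 2 = 0" "Suc c div 2 = Suc (c div 2)" by presburger+
      then show ?thesis using \<open>c < 2 * n\<close> False by (simp add: f_def g_def)
    qed
  qed
  also have "\<dots> = (\<Prod>i<n. \<Prod>j<n. a i - a (n + j)) *
    fdet n (\<lambda>i j. (a i * b (n + j) - a (n + j) * b i) / (a (n + j) - a i))"
  proof (rule fdet_two_families)
    show "inj_on (\<lambda>j. a (n + j)) {..<n}"
    proof (rule inj_onI)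
      fix x y assume "x \<in> {..<n}" "y \<in> {..<n}" "a (n + x) = a (n + y)"
      then show "x = y" using inj_onD[OF inj, of "n + x" "n + y"] by (simp add: a_def)
    qed
    show "a i \<noteq> a (n + j)" if "i < n" "j < n" for i j
      using that inj_onD[OF inj, of i "n + j"] by (auto simp: a_def)
    show "a (n + j) \<noteq> 0" if "j < n" for j
      using that inj_onD[OF inj, of "n + j" "2 * n"] by (auto simp: a_def)
  qed
  finally show ?thesis by (simp add: a_def b_def)
qed

section \<open>A determinant formula for \<open>S\<^sub>n\<close> that is symmetric in all variables\<close>

definition P_poly :: "complex \<Rightarrow> complex \<Rightarrow> complex" where
  "P_poly \<zeta> x = x\<^sup>2 * (x - (2 * \<zeta> + 1))"

definition Q_poly :: "complex \<Rightarrow> complex \<Rightarrow> complex" where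
  "Q_poly \<zeta> x = (\<zeta> + 2) * x - \<zeta>"

definition R_poly :: "complex \<Rightarrow> complex" where
  "R_poly x = x * (x + 1)"

lemma G_poly_eq: "(x - y) * G_poly \<zeta> x y = P_poly \<zeta> x * Q_poly \<zeta> y - Q_poly \<zeta> x * P_poly \<zeta> y"
  by (simp add: G_poly_def P_poly_def Q_poly_def algebra_simps power2_eq_square)

text \<open>The right-hand side is the alternant of P, R, Q at x, y, z expanded along the column of
  Q.\<close>

lemma F_poly_eq:
  "F_poly \<zeta> x y z * ((x - y) * (x - z) * (y - z)) =
    (P_poly \<zeta> x * R_poly y - R_poly x * P_poly \<zeta> y) * Q_poly \<zeta> z
    - (P_poly \<zeta> x * R_poly z - R_poly x * P_poly \<zeta> z) * Q_poly \<zeta> y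
    + (P_poly \<zeta> y * R_poly z - R_poly y * P_poly \<zeta> z) * Q_poly \<zeta> x"
  by (simp add: F_poly_def P_poly_def Q_poly_def R_poly_def algebra_simps power2_eq_square)

text \<open>Dividing by Q turns the alternant of P, Q, R into one of h, 1, r, and subtracting its
  values at z leaves a 2 x 2 determinant: the kernel of \<open>alt_det_odd\<close>. The other
  factors depend only on x and z or only on y and z, so they leave the determinant as row and column
  factors.\<close>

lemma F_G_quotient:
  fixes \<zeta> :: complex
  defines "h \<equiv> \<lambda>x. P_poly \<zeta> x / Q_poly \<zeta> x" and "r \<equiv> \<lambda>x. R_poly x / Q_poly \<zeta> x"
  assumes nz: "Q_poly \<zeta> x \<noteq> 0" "Q_poly \<zeta> y \<noteq> 0" "Q_poly \<zeta> z \<noteq> 0"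
    and ne: "x \<noteq> y" "x \<noteq> z" "y \<noteq> z" and G: "G_poly \<zeta> x y \<noteq> 0"
  shows "F_poly \<zeta> x y z / G_poly \<zeta> x y = (- Q_poly \<zeta> z / (x - z)) * ((1 / (y - z)) *
    (((h x - h z) * (r y - r z) - (h y - h z) * (r x - r z)) / (h y - h x)))"
proof -
  have hyx: "h y - h x = - (x - y) * G_poly \<zeta> x y / (Q_poly \<zeta> x * Q_poly \<zeta> y)"
    using nz G_poly_eq[of x y \<zeta>] by (simp add: h_def field_simps)
  have num: "(h x - h z) * (r y - r z) - (h y - h z) * (r x - r z) =
    F_poly \<zeta> x y z * ((x - y) * (x - z) * (y - z)) / (Q_poly \<zeta> x * Q_poly \<zeta> y * Q_poly \<zeta> z)"
    unfolding F_poly_eq h_def r_def using nz by (simp add: field_simps)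
  have "F / g = (- q / d2) * ((1 / d3) * ((F * (d1 * d2 * d3) / (a * b * q)) / (- d1 * g / (a * b))))"
    if "g \<noteq> 0" "q \<noteq> 0" "d1 \<noteq> 0" "d2 \<noteq> 0" "d3 \<noteq> 0" "a \<noteq> 0" "b \<noteq> 0" for F g q d1 d2 d3 a b :: complex
    using that by (simp add: field_simps)
  then show ?thesis
    unfolding hyx num by this (use nz ne G in auto)
qed

text \<open>For c up to 2 n the exponent of Q is not truncated: c = 2 k gives Q^(n-k) P^k, and c = 2
  k + 1 gives R Q^(n-1-k) P^k.\<close>

definition S_col :: "complex \<Rightarrow> nat \<Rightarrow> nat \<Rightarrow> complex \<Rightarrow> complex" where
  "S_col \<zeta> n c x = Q_poly \<zeta> x ^ (n - c mod 2 - c div 2) * R_poly x ^ (c mod 2) * P_poly \<zeta> x ^ (c div 2)"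

lemma fdet_S_col:
  assumes "\<And>i. i < 2 * n + 1 \<Longrightarrow> Q_poly \<zeta> (w i) \<noteq> 0"
  shows "fdet (2 * n + 1) (\<lambda>i c. S_col \<zeta> n c (w i)) = (\<Prod>i<2 * n + 1. Q_poly \<zeta> (w i) ^ n) *
    alt_det (2 * n + 1) (\<lambda>i. R_poly (w i) / Q_poly \<zeta> (w i)) (\<lambda>i. P_poly \<zeta> (w i) / Q_poly \<zeta> (w i))"
  unfolding alt_det_def fdet_scale_rows[symmetric]
proof (rule fdet_cong)
  fix i c assume i: "i < 2 * n + 1" and c: "c < 2 * n + 1"
  have "c mod 2 + c div 2 \<le> n" using c by presburger
  then have "Q_poly \<zeta> (w i) ^ n =
    Q_poly \<zeta> (w i) ^ (n - c mod 2 - c div 2) * Q_poly \<zeta> (w i) ^ (c mod 2) * Q_poly \<zeta> (w i) ^ (c div 2)"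
    by (simp flip: power_add)
  then show "S_col \<zeta> n c (w i) = Q_poly \<zeta> (w i) ^ n *
      ((R_poly (w i) / Q_poly \<zeta> (w i)) ^ (c mod 2) * (P_poly \<zeta> (w i) / Q_poly \<zeta> (w i)) ^ (c div 2))"
    using assms[OF i] by (simp add: S_col_def power_divide)
qed

lemma vprod_split:
  "vprod (2 * n + 1) w = vprod n w * vprod n (\<lambda>j. w (n + j)) * (\<Prod>i<n. \<Prod>j<n. w (n + j) - w i)
    * (\<Prod>i<n. w (2 * n) - w i) * (\<Prod>j<n. w (2 * n) - w (n + j))"
proof -
  have "vprod (2 * n + 1) w = vprod (n + n) w * (\<Prod>j<n + n. w (2 * n) - w j)"
    by (simp add: vprod_def mult_2)
  also have "vprod (n + n) w = vprod n w * (\<Prod>i<n. (\<Prod>j<n + i. w (n + i) - w j))"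
    by (simp add: vprod_def prod_lessThan_add)
  also have "(\<Prod>i<n. (\<Prod>j<n + i. w (n + i) - w j)) =
    (\<Prod>i<n. \<Prod>j<n. w (n + i) - w j) * vprod n (\<lambda>j. w (n + j))"
    by (simp add: vprod_def prod_lessThan_add prod.distrib)
  also have "(\<Prod>i<n. \<Prod>j<n. w (n + i) - w j) = (\<Prod>i<n. \<Prod>j<n. w (n + j) - w i)"
    by (rule prod.swap)
  finally show ?thesis by (simp add: prod_lessThan_add mult_ac)
qed

text \<open>Both the Vandermonde product and the alternant treat the 2 n + 1 arguments alike,
  although the quotient for S_n does not. The hypotheses make all divisions legitimate; in the
  application they hold for \<zeta> near -2.\<close>

proposition S_poly_eq:
  fixes v :: "nat \<Rightarrow> complex"
  defines "w \<equiv> \<lambda>i. v (Suc i)"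
  assumes Q: "\<And>i. i < 2 * n + 1 \<Longrightarrow> Q_poly \<zeta> (w i) \<noteq> 0"
    and inj: "inj_on w {..<2 * n + 1}"
    and G: "\<And>i j. i < j \<Longrightarrow> j < 2 * n + 1 \<Longrightarrow> G_poly \<zeta> (w i) (w j) \<noteq> 0"
  shows "S_poly n \<zeta> v * vprod (2 * n + 1) w = fdet (2 * n + 1) (\<lambda>i c. S_col \<zeta> n c (w i))"
proof -
  define h where "h i = P_poly \<zeta> (w i) / Q_poly \<zeta> (w i)" for i
  define r where "r i = R_poly (w i) / Q_poly \<zeta> (w i)" for i
  let ?z = "2 * n"
  let ?E = "fdet n (\<lambda>i j. ((h i - h ?z) * (r (n + j) - r ?z) - (h (n + j) - h ?z) * (r i - r ?z))
      / (h (n + j) - h i))"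
  have diff: "h i - h j = (w i - w j) * G_poly \<zeta> (w i) (w j) / (Q_poly \<zeta> (w i) * Q_poly \<zeta> (w j))"
    if "i < 2 * n + 1" "j < 2 * n + 1" for i j
    using Q[OF that(1)] Q[OF that(2)] G_poly_eq[of "w i" "w j" \<zeta>] by (simp add: h_def field_simps)
  have hne: "h i \<noteq> h j" if "i < j" "j < 2 * n + 1" for i j
  proof -
    have "w i \<noteq> w j" using inj_onD[OF inj, of i j] that by auto
    then show ?thesis using diff[of i j] Q[of i] Q[of j] G[OF that] that by auto
  qed
  have inj_h: "inj_on h {..<2 * n + 1}"
    by (rule linorder_inj_onI') (use hne in auto)
  have det: "det_upto n (\<lambda>i j. F_poly \<zeta> (v i) (v (n + j)) (v (2 * n + 1)) / G_poly \<zeta> (v i) (v (n + j))) =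
    (\<Prod>i<n. - Q_poly \<zeta> (w ?z) / (w i - w ?z)) * ((\<Prod>j<n. 1 / (w (n + j) - w ?z)) * ?E)"
  proof -
    have "det_upto n (\<lambda>i j. F_poly \<zeta> (v i) (v (n + j)) (v (2 * n + 1)) / G_poly \<zeta> (v i) (v (n + j))) =
      fdet n (\<lambda>i j. F_poly \<zeta> (w i) (w (n + j)) (w ?z) / G_poly \<zeta> (w i) (w (n + j)))"
      by (simp add: det_upto_def fdet_def w_def)
    also have "\<dots> = fdet n (\<lambda>i j. (- Q_poly \<zeta> (w ?z) / (w i - w ?z)) * ((1 / (w (n + j) - w ?z)) *
      (((h i - h ?z) * (r (n + j) - r ?z) - (h (n + j) - h ?z) * (r i - r ?z)) / (h (n + j) - h i))))"
    proof (rule fdet_cong)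
      fix i j assume ij: "i < n" "j < n"
      have "w i \<noteq> w (n + j)" "w i \<noteq> w ?z" "w (n + j) \<noteq> w ?z"
        using ij inj_onD[OF inj, of i "n + j"] inj_onD[OF inj, of i ?z] inj_onD[OF inj, of "n + j" ?z]
        by auto
      then show "F_poly \<zeta> (w i) (w (n + j)) (w ?z) / G_poly \<zeta> (w i) (w (n + j)) =
        (- Q_poly \<zeta> (w ?z) / (w i - w ?z)) * ((1 / (w (n + j) - w ?z)) *
        (((h i - h ?z) * (r (n + j) - r ?z) - (h (n + j) - h ?z) * (r i - r ?z)) / (h (n + j) - h i)))"
        unfolding h_def r_def using ij by (intro F_G_quotient Q G) auto
    qed
    finally show ?thesis by (simp only: fdet_scale_rows fdet_scale_cols)
  qed
  have prodG: "(\<Prod>i=1..n. \<Prod>j=1..n. G_poly \<zeta> (v i) (v (n + j))) =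
    (\<Prod>i<n. \<Prod>j<n. G_poly \<zeta> (w i) (w (n + j)))"
    by (simp add: prod.atLeast1_atMost_eq w_def)
  have den: "(\<Prod>i=1..n. \<Prod>j=i+1..n. (v j - v i) * (v (n + j) - v (n + i))) =
    vprod n w * vprod n (\<lambda>j. w (n + j))"
    by (simp only: prod_pairs_eq prod.distrib) (simp add: vprod_def w_def)
  let ?QX = "\<Prod>i<n. Q_poly \<zeta> (w i) ^ n" and ?QY = "\<Prod>j<n. Q_poly \<zeta> (w (n + j)) ^ n"
  let ?D = "\<Prod>i<n. \<Prod>j<n. w i - w (n + j)"
  \<comment> \<open>Each x_i and each y_j occurs in n of the n^2 differences, so clearing
    denominators costs exactly Q^n per argument.\<close>
  have hprod: "(\<Prod>i<n. \<Prod>j<n. h i - h (n + j)) * (?QX * ?QY) =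
    ?D * (\<Prod>i<n. \<Prod>j<n. G_poly \<zeta> (w i) (w (n + j)))"
  proof -
    have "?QX * ?QY = (\<Prod>i<n. \<Prod>j<n. Q_poly \<zeta> (w i) * Q_poly \<zeta> (w (n + j)))"
      by (simp add: prod.distrib prod.swap[of "\<lambda>i j. Q_poly \<zeta> (w (n + j))"] prod_power_distrib)
    then have "(\<Prod>i<n. \<Prod>j<n. h i - h (n + j)) * (?QX * ?QY) =
      (\<Prod>i<n. \<Prod>j<n. (h i - h (n + j)) * (Q_poly \<zeta> (w i) * Q_poly \<zeta> (w (n + j))))"
      by (simp only: prod.distrib)
    also have "\<dots> = (\<Prod>i<n. \<Prod>j<n. (w i - w (n + j)) * G_poly \<zeta> (w i) (w (n + j)))"
      by (intro prod.cong refl) (use diff Q in simp)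
    finally show ?thesis by (simp only: prod.distrib)
  qed
  have ne: "?D \<noteq> 0" "(\<Prod>i<n. w ?z - w i) \<noteq> 0" "(\<Prod>j<n. w ?z - w (n + j)) \<noteq> 0"
  proof -
    have *: "w i \<noteq> w j" if "i < j" "j < 2 * n + 1" for i j
      using inj_onD[OF inj, of i j] that by auto
    have "w i \<noteq> w (n + j)" "w ?z \<noteq> w i" "w ?z \<noteq> w (n + j)" if "i < n" "j < n" for i j
      using *[of i "n + j"] *[of i ?z] *[of "n + j" ?z] that by auto
    then show "?D \<noteq> 0" "(\<Prod>i<n. w ?z - w i) \<noteq> 0" "(\<Prod>j<n. w ?z - w (n + j)) \<noteq> 0"
      by auto
  qed
  have v0: "vprod n w \<noteq> 0" "vprod n (\<lambda>j. w (n + j)) \<noteq> 0"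
  proof -
    show "vprod n w \<noteq> 0" unfolding vprod_nonzero_iff by (rule inj_on_subset[OF inj]) auto
    show "vprod n (\<lambda>j. w (n + j)) \<noteq> 0"
      unfolding vprod_nonzero_iff
    proof (rule inj_onI)
      fix x y assume "x \<in> {..<n}" "y \<in> {..<n}" "w (n + x) = w (n + y)"
      then show "x = y" using inj_onD[OF inj, of "n + x" "n + y"] by simp
    qed
  qed
  have vs: "vprod (2 * n + 1) w = vprod n w * vprod n (\<lambda>j. w (n + j)) * ((-1) ^ n * ?D)
    * (\<Prod>i<n. w ?z - w i) * (\<Prod>j<n. w ?z - w (n + j))"
  proof -
    have "(\<Prod>i<n. \<Prod>j<n. w (n + j) - w i) = (\<Prod>i<n. \<Prod>j<n. - (w i - w (n + j)))" by simp
    also have "\<dots> = (-1) ^ n * ?D"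
    proof -
      \<comment> \<open>n^2 and n have the same parity.\<close>
      have "((-1 :: complex) ^ n) ^ n = (-1) ^ n"
        by (cases "even n") auto
      then show ?thesis by (simp only: prod_uminus prod.distrib) simp
    qed
    finally show ?thesis unfolding vprod_split by simp
  qed
  have rows: "(\<Prod>i<n. - Q_poly \<zeta> (w ?z) / (w i - w ?z)) = Q_poly \<zeta> (w ?z) ^ n / (\<Prod>i<n. w ?z - w i)"
  proof -
    have "(\<Prod>i<n. - Q_poly \<zeta> (w ?z) / (w i - w ?z)) = (\<Prod>i<n. Q_poly \<zeta> (w ?z) / (w ?z - w i))"
      by (rule prod.cong) (auto simp: divide_simps algebra_simps)
    then show ?thesis by (simp add: prod_dividef)
  qed
  have cols: "(\<Prod>j<n. 1 / (w (n + j) - w ?z)) = (-1) ^ n / (\<Prod>j<n. w ?z - w (n + j))"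
  proof -
    have "(\<Prod>j<n. 1 / (w (n + j) - w ?z)) = (\<Prod>j<n. - (1 / (w ?z - w (n + j))))"
      by (rule prod.cong) (auto simp: divide_simps)
    then show ?thesis by (simp only: prod_uminus prod_dividef) simp
  qed
  have "S_poly n \<zeta> v = (\<Prod>i<n. \<Prod>j<n. G_poly \<zeta> (w i) (w (n + j))) /
    (vprod n w * vprod n (\<lambda>j. w (n + j))) * (Q_poly \<zeta> (w ?z) ^ n / (\<Prod>i<n. w ?z - w i)
      * ((-1) ^ n / (\<Prod>j<n. w ?z - w (n + j)) * ?E))"
    unfolding S_poly_def Let_def prodG den det rows cols ..
  \<comment> \<open>Here e is (-1)^n. It occurs once from the Vandermonde product and once from the
    column factors, hence as a square.\<close>
  moreover have "s * (v1 * v2 * (e * d) * z1 * z2) = d * g * q * E * (e * e)"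
    if "s = g / (v1 * v2) * (q / z1 * (e / z2 * E))" "v1 \<noteq> 0" "v2 \<noteq> 0" "z1 \<noteq> 0" "z2 \<noteq> 0"
    for s v1 v2 e d z1 z2 g q E :: complex
    using that by simp
  ultimately have "S_poly n \<zeta> v * vprod (2 * n + 1) w =
    ?D * (\<Prod>i<n. \<Prod>j<n. G_poly \<zeta> (w i) (w (n + j))) * Q_poly \<zeta> (w ?z) ^ n * ?E * ((-1) ^ n * (-1) ^ n)"
    unfolding vs using ne v0 by blast
  also have "\<dots> = ?QX * ?QY * Q_poly \<zeta> (w ?z) ^ n * ((\<Prod>i<n. \<Prod>j<n. h i - h (n + j)) * ?E)"
    unfolding hprod[symmetric] by (simp flip: power_add)
  also have "(\<Prod>i<n. \<Prod>j<n. h i - h (n + j)) * ?E = alt_det (2 * n + 1) r h"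
    by (rule alt_det_odd[OF inj_h, symmetric])
  also have "?QX * ?QY * Q_poly \<zeta> (w ?z) ^ n = (\<Prod>i<2 * n + 1. Q_poly \<zeta> (w i) ^ n)"
    using prod_lessThan_add[of "\<lambda>i. Q_poly \<zeta> (w i) ^ n" n n] by (simp add: mult_2)
  also have "(\<Prod>i<2 * n + 1. Q_poly \<zeta> (w i) ^ n) * alt_det (2 * n + 1) r h =
    fdet (2 * n + 1) (\<lambda>i c. S_col \<zeta> n c (w i))"
    using fdet_S_col[of n \<zeta> w, OF Q] by (simp add: h_def[abs_def] r_def[abs_def])
  finally show ?thesis .
qed

section \<open>The characters as alternating determinants\<close>

lemma minus_one_power_triangular:
  "(-1) ^ (N * (N - 1) div 2) = (\<Prod>i<N. (-1) ^ i :: 'a :: comm_ring_1)"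
proof (induction N)
  case (Suc N)
  have "Suc N * (Suc N - 1) = N * (N - 1) + 2 * N" by (cases N) auto
  then have "Suc N * (Suc N - 1) div 2 = N * (N - 1) div 2 + N" by simp
  then show ?case using Suc by (simp only: power_add) simp
qed simp

text \<open>Continued two steps backwards, the recurrence \<open>g4\<close> yields \<open>g2\<close>
  and \<open>g3\<close> when g(-2) = - g 1 and g(-1) = - g 0. This reflection closes the system:
  every correction is an earlier column.\<close>

lemma fdet_char_recurrence:
  fixes g :: "nat \<Rightarrow> nat \<Rightarrow> 'a :: field"
  assumes g0: "\<And>i. g 0 i = 1" and g1: "\<And>i. g 1 i = r i + \<kappa>"
    and g2: "\<And>i. g 2 i = C i * g 0 i + g 1 i" and g3: "\<And>i. g 3 i = C i * g 1 i + g 0 i"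
    and g4: "\<And>c i. g (c + 4) i = C i * g (c + 2) i - g c i"
  shows "fdet N (\<lambda>i c. g c i) = alt_det N r C"
  unfolding alt_det_def
proof (rule fdet_recurrence[of 2 "\<lambda>c i. r i ^ (c mod 2) * C i ^ (c div 2)" C g])
  let ?f = "\<lambda>c i. r i ^ (c mod 2) * C i ^ (c div 2)"
  fix c :: nat
  show "lspan c ?f (\<lambda>i. g c i - ?f c i)" if "c < 2"
  proof (cases "c = 0")
    case True
    then show ?thesis by (simp add: lspan_zero g0)
  next
    case False
    then have "c = 1" using that by simp
    moreover have "lspan 1 ?f (\<lambda>i. \<kappa> * ?f 0 i)"
      by (rule lspan_scale[OF lspan_base]) simp
    ultimately show ?thesis using g1 by simp
  qed
  consider "c = 0" | "c = 1" | d where "c = d + 2"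
    using le_Suc_ex[of 2 c] by (cases "c < 2") (auto simp: less_2_cases_iff)
  then show "lspan (c + 2) g (\<lambda>i. g (c + 2) i - C i * g c i)"
  proof cases
    case 1
    have "lspan 2 g (g 1)" by (rule lspan_base) simp
    then show ?thesis by (simp only: 1 add_0 g2 add_diff_cancel_left')
  next
    case 2
    have "lspan 3 g (g 0)" by (rule lspan_base) simp
    moreover have "c + 2 = 3" using 2 by simp
    ultimately show ?thesis by (simp only: 2 g3 add_diff_cancel_left')
  next
    case (3 d)
    have "lspan (d + 4) g (\<lambda>i. (- 1) * g d i)" by (rule lspan_scale[OF lspan_base]) simp
    moreover have e: "c + 2 = d + 4" using 3 by simp
    moreover have "(\<lambda>i. g (c + 2) i - C i * g c i) = (\<lambda>i. (- 1) * g d i)"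
      by (rule ext) (simp only: e g4, simp add: 3)
    ultimately show ?thesis by (simp only:)
  qed
qed auto

text \<open>The entries of both character numerators; for the orthogonal character x is a square
  root of t_j and k is odd.\<close>

definition skew_power :: "int \<Rightarrow> complex \<Rightarrow> complex" where
  "skew_power k x = x powi (- k) - x powi k"

lemma skew_power_add:
  "x \<noteq> 0 \<Longrightarrow> skew_power (k + d) x = (x powi d + x powi (- d)) * skew_power k x - skew_power (k - d) x"
  by (simp add: skew_power_def power_int_add power_int_diff power_int_minus field_simps)

lemma skew_power_uminus: "skew_power (- k) x = - skew_power k x"
  by (simp add: skew_power_def)

text \<open>The exponents form two progressions of difference d starting at 1 and d - 1, that is,
  the positive integers congruent to 1 or -1 mod d. Stepping back by d from the first two reflects
  them into each other, and oddness in the exponent supplies the minus signs.\<close>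

lemma fdet_skew_power:
  assumes x: "\<And>i. i < N \<Longrightarrow> x i \<noteq> 0" "\<And>i. i < N \<Longrightarrow> skew_power 1 (x i) \<noteq> 0"
    and \<eta>0: "\<eta> 0 = 1" and \<eta>2: "\<And>c. \<eta> (c + 2) = \<eta> c + d" and \<eta>1: "\<eta> 0 - d = - \<eta> 1"
    and r: "\<And>i. i < N \<Longrightarrow> skew_power (\<eta> 1) (x i) = (r i + \<kappa>) * skew_power 1 (x i)"
    and C: "\<And>i. i < N \<Longrightarrow> C i = x i powi d + x i powi (- d)"
  shows "fdet N (\<lambda>i c. skew_power (\<eta> c) (x i)) = (\<Prod>i<N. skew_power 1 (x i)) * alt_det N r C"
proof -
  \<comment> \<open>The recurrence is required in every row, so rows beyond N get a default; 2 is
    nonzero and 1/2 - 2 is nonzero, which keeps the divisions valid.\<close>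
  define X where "X i = (if i < N then x i else 2)" for i
  define g where "g c i = skew_power (\<eta> c) (X i) / skew_power 1 (X i)" for c i
  define C' where "C' i = X i powi d + X i powi (- d)" for i
  have X: "X i \<noteq> 0" "skew_power 1 (X i) \<noteq> 0" for i
    using x by (auto simp: X_def skew_power_def power_int_minus)
  have step: "g (c + 2) i = C' i * g c i - skew_power (\<eta> c - d) (X i) / skew_power 1 (X i)" for c i
    unfolding g_def \<eta>2 skew_power_add[OF X(1)] C'_def by (simp add: diff_divide_distrib)
  have *: "skew_power (\<eta> 0 - d) (X i) = - skew_power (\<eta> 1) (X i)"
    "skew_power (\<eta> 1 - d) (X i) = - skew_power (\<eta> 0) (X i)" for i
  proof -
    have "\<eta> 1 - d = - \<eta> 0" using \<eta>1 by simp
    then show "skew_power (\<eta> 0 - d) (X i) = - skew_power (\<eta> 1) (X i)"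
      "skew_power (\<eta> 1 - d) (X i) = - skew_power (\<eta> 0) (X i)"
      unfolding \<eta>1 by (simp_all add: skew_power_uminus)
  qed
  have "fdet N (\<lambda>i c. skew_power (\<eta> c) (x i)) = fdet N (\<lambda>i c. skew_power 1 (x i) * g c i)"
    by (rule fdet_cong) (use x in \<open>auto simp: g_def X_def\<close>)
  also have "\<dots> = (\<Prod>i<N. skew_power 1 (x i)) * fdet N (\<lambda>i c. g c i)"
    by (rule fdet_scale_rows)
  also have "fdet N (\<lambda>i c. g c i) = alt_det N (\<lambda>i. g 1 i - \<kappa>) C'"
  proof (rule fdet_char_recurrence[where \<kappa> = \<kappa>])
    fix i
    show "g 0 i = 1" using X[of i] by (simp add: g_def \<eta>0)
    show "g 1 i = g 1 i - \<kappa> + \<kappa>" by simp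
    show "g 2 i = C' i * g 0 i + g 1 i"
      using step[of 0 i] unfolding *(1) add_0 by (simp add: g_def)
    show "g 3 i = C' i * g 1 i + g 0 i"
    proof -
      have e: "(1 :: nat) + 2 = 3" by simp
      show ?thesis using step[of 1 i] unfolding *(2) e by (simp add: g_def)
    qed
    show "g (c + 4) i = C' i * g (c + 2) i - g c i" for c
    proof -
      have e: "c + 2 + 2 = c + 4" by simp
      show ?thesis using step[of "c + 2" i] unfolding \<eta>2[of c] e add_diff_cancel_right' g_def[of c, symmetric] .
    qed
  qed
  also have "\<dots> = alt_det N r C"
    by (rule alt_det_cong) (use r C x in \<open>auto simp: g_def C'_def X_def\<close>)
  finally show ?thesis .
qed

section \<open>Weyl denominators as Vandermonde products in t + t^-1\<close>

lemma prod_pairs_mult: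
  fixes U :: "nat \<Rightarrow> 'a :: field"
  shows "(\<Prod>j<N. \<Prod>i<j. U i * U j) = (\<Prod>i<N. U i ^ (N - 1))"
proof (induction N)
  case (Suc N)
  have "(\<Prod>i<N. U i ^ (N - 1)) * (\<Prod>i<N. U i) = (\<Prod>i<N. U i ^ N)"
  proof (cases N)
    case (Suc k)
    then show ?thesis by (simp add: prod.distrib mult_ac)
  qed simp
  then show ?case using Suc by (simp add: prod.distrib prod_constant mult_ac flip: mult.assoc)
qed simp

text \<open>Each factor (U_j - U_i)(1 - U_i U_j) is - U_i U_j times the difference of the values of
  U + U^-1, and each U_i belongs to N - 1 pairs.\<close>

lemma weyl_product:
  fixes U :: "nat \<Rightarrow> complex"
  assumes "\<And>i. i < N \<Longrightarrow> U i \<noteq> 0"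
  shows "(\<Prod>j<N. \<Prod>i<j. (U j - U i) * (1 - U i * U j)) =
    (-1) ^ (N * (N - 1) div 2) * (\<Prod>i<N. U i ^ (N - 1)) * vprod N (\<lambda>i. U i + inverse (U i))"
proof -
  have "(\<Prod>j<N. \<Prod>i<j. (U j - U i) * (1 - U i * U j)) =
    (\<Prod>j<N. \<Prod>i<j. (-1) * ((U i * U j) * ((U j + inverse (U j)) - (U i + inverse (U i)))))"
  proof (intro prod.cong refl)
    fix i j assume "j \<in> {..<N}" "i \<in> {..<j}"
    then have "U i \<noteq> 0" "U j \<noteq> 0" using assms by auto
    then show "(U j - U i) * (1 - U i * U j) =
      (-1) * ((U i * U j) * ((U j + inverse (U j)) - (U i + inverse (U i))))"
      by (simp add: field_simps)
  qed
  also have "\<dots> = (\<Prod>j<N. \<Prod>i<j. -1) * ((\<Prod>j<N. \<Prod>i<j. U i * U j) * vprod N (\<lambda>i. U i + inverse (U i)))"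
    by (simp only: prod.distrib vprod_def)
  finally show ?thesis
    unfolding prod_pairs_mult minus_one_power_triangular by (simp add: mult.assoc)
qed

lemma fdet_reverse_rows:
  "fdet N (\<lambda>i j. f (N - 1 - i) j) = (-1) ^ (N * (N - 1) div 2) * fdet N (\<lambda>i j. f j i)"
  using fdet_reverse_cols[of N "\<lambda>i j. f j i"] fdet_transpose[of N "\<lambda>i j. f (N - 1 - i) j"] by simp

text \<open>The factor u_i^(N-1) released by the pair product turns u_i^(-N) (1 - u_i^2) into u_i^-1
  - u_i, which the numerator also contains.\<close>

lemma sp_denom_eq:
  assumes "\<And>i. i \<in> {1..N} \<Longrightarrow> u i \<noteq> 0"
  shows "sp_denom N u = (-1) ^ (N * (N - 1) div 2) * (\<Prod>i<N. skew_power 1 (u (Suc i))) *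
    vprod N (\<lambda>i. u (Suc i) + inverse (u (Suc i)))"
proof -
  have u: "u (Suc i) \<noteq> 0" if "i < N" for i using assms that by auto
  have "(\<Prod>i=1..N. u i powi (- int N) * (1 - (u i)\<^sup>2)) * (\<Prod>i<N. u (Suc i) ^ (N - 1)) =
    (\<Prod>i<N. u (Suc i) powi (- int N) * (1 - (u (Suc i))\<^sup>2) * u (Suc i) ^ (N - 1))"
    by (simp add: prod.atLeast1_atMost_eq prod.distrib)
  also have "\<dots> = (\<Prod>i<N. skew_power 1 (u (Suc i)))"
  proof (intro prod.cong refl)
    fix i assume "i \<in> {..<N}"
    then obtain k where N: "N = Suc k" by (cases N) auto
    have "u (Suc i) powi (- int N) = inverse (u (Suc i) ^ N)" by (simp add: power_int_minus)
    then show "u (Suc i) powi (- int N) * (1 - (u (Suc i))\<^sup>2) * u (Suc i) ^ (N - 1) = skew_power 1 (u (Suc i))"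
      using u[of i] \<open>i \<in> _\<close> by (simp add: N skew_power_def power_int_minus field_simps power2_eq_square del: of_nat_Suc)
  qed
  finally show ?thesis
    unfolding sp_denom_def prod_pairs_eq
    by (subst weyl_product) (use u in \<open>auto simp: mult_ac\<close>)
qed

lemma so_denom_eq:
  assumes "\<And>i. i \<in> {1..N} \<Longrightarrow> t i \<noteq> 0"
  shows "so_denom N t = (-1) ^ (N * (N - 1) div 2) * (\<Prod>i<N. skew_power 1 (t (Suc i) powr (1/2))) *
    vprod N (\<lambda>i. t (Suc i) + inverse (t (Suc i)))"
proof -
  have t: "t (Suc i) \<noteq> 0" if "i < N" for i using assms that by auto
  have "(\<Prod>i=1..N. t i powr (1/2 - of_nat N) * (1 - t i)) * (\<Prod>i<N. t (Suc i) ^ (N - 1)) =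
    (\<Prod>i<N. t (Suc i) powr (1/2 - of_nat N) * (1 - t (Suc i)) * t (Suc i) ^ (N - 1))"
    by (simp add: prod.atLeast1_atMost_eq prod.distrib)
  also have "\<dots> = (\<Prod>i<N. skew_power 1 (t (Suc i) powr (1/2)))"
  proof (intro prod.cong refl)
    fix i assume i: "i \<in> {..<N}"
    then obtain k where N: "N = Suc k" by (cases N) auto
    let ?x = "t (Suc i)" and ?s = "t (Suc i) powr (1/2)"
    have nz: "?x \<noteq> 0" "?s \<noteq> 0" using t i by auto
    have sq: "?s * ?s = ?x" using nz by (simp add: powr_add[symmetric])
    have "?x powr (1/2 - of_nat N) = ?s / ?x ^ N"
      using nz by (simp add: powr_diff powr_nat)
    then have "?x powr (1/2 - of_nat N) * (1 - ?x) * ?x ^ (N - 1) = ?s / ?x * (1 - ?x)"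
      using nz N by (simp add: field_simps)
    also have "s / x * (1 - x) = skew_power 1 s" if "s \<noteq> 0" "s * s = x" for s x
      using that by (auto simp: skew_power_def power_int_minus field_simps)
    then have "?s / ?x * (1 - ?x) = skew_power 1 ?s" using nz sq by blast
    finally show "?x powr (1/2 - of_nat N) * (1 - ?x) * ?x ^ (N - 1) = skew_power 1 ?s" .
  qed
  finally show ?thesis
    unfolding so_denom_def prod_pairs_eq
    by (subst weyl_product) (use t in \<open>auto simp: mult_ac\<close>)
qed

text \<open>Read from the last row, the exponents are 1, 2, 4, 5, 7, 8, ..., so d = 3. The second
  entry divided by the first is b; the translation by 1 is free and anticipates that 1/y is
  proportional to 1 + b.\<close>

lemma sp_char_eq:
  fixes u :: "nat \<Rightarrow> complex"
  defines "b \<equiv> \<lambda>i. u (Suc i) + inverse (u (Suc i))"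
  assumes u: "\<And>i. i \<in> {1..N} \<Longrightarrow> u i \<noteq> 0" and den: "sp_denom N u \<noteq> 0"
    and l: "\<And>c. c < N \<Longrightarrow> l (N - c) = c div 2"
  shows "sp_char N l u = alt_det N (\<lambda>i. 1 + b i) (\<lambda>i. u (Suc i) ^ 3 + inverse (u (Suc i)) ^ 3) / vprod N b"
proof -
  define \<eta> where "\<eta> c = int (c div 2 + c + 1)" for c
  let ?U = "\<lambda>i. u (Suc i)" and ?\<epsilon> = "(-1) ^ (N * (N - 1) div 2) :: complex"
  have den_eq: "sp_denom N u = ?\<epsilon> * (\<Prod>i<N. skew_power 1 (?U i)) * vprod N b"
    unfolding b_def by (rule sp_denom_eq) (use u in auto)
  have nz: "?\<epsilon> \<noteq> 0" "(\<Prod>i<N. skew_power 1 (?U i)) \<noteq> 0" "vprod N b \<noteq> 0"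
    using den unfolding den_eq by auto
  have "det_upto N (\<lambda>i j. u j powi (- (int (l i) + int N - int i + 1)) - u j powi (int (l i) + int N - int i + 1)) =
    fdet N (\<lambda>i j. skew_power (\<eta> (N - 1 - i)) (?U j))"
  proof -
    have "int (l (Suc i)) + int N - int (Suc i) + 1 = \<eta> (N - 1 - i)" if "i < N" for i
      using l[of "N - 1 - i"] that by (simp add: \<eta>_def)
    then show ?thesis unfolding det_upto_def fdet_def[symmetric]
      by (intro fdet_cong) (simp only: skew_power_def)
  qed
  also have "\<dots> = ?\<epsilon> * fdet N (\<lambda>i c. skew_power (\<eta> c) (?U i))"
    by (rule fdet_reverse_rows)
  also have "fdet N (\<lambda>i c. skew_power (\<eta> c) (?U i)) =
    (\<Prod>i<N. skew_power 1 (?U i)) * alt_det N (\<lambda>i. 1 + b i) (\<lambda>i. ?U i ^ 3 + inverse (?U i) ^ 3)"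
  proof (rule fdet_skew_power[where d = 3 and \<kappa> = "-1"])
    fix i assume i: "i < N"
    show U: "?U i \<noteq> 0" using u i by auto
    show "skew_power 1 (?U i) \<noteq> 0" using nz i by auto
    show "skew_power (\<eta> 1) (?U i) = (1 + b i + -1) * skew_power 1 (?U i)"
      using U by (simp add: \<eta>_def skew_power_def b_def power_int_minus power2_eq_square field_simps)
    show "?U i ^ 3 + inverse (?U i) ^ 3 = ?U i powi 3 + ?U i powi - 3"
      by (simp add: power_int_minus power_inverse)
  qed (simp_all add: \<eta>_def)
  finally show ?thesis
    unfolding sp_char_def den_eq using nz by simp
qed

text \<open>With A = x^2 + s^2 the quotient s^4 + s^2 + 1 + x^2 + x^4 is (A^2 - 2) + A + 1.\<close>

lemma skew_power_5_identity:
  fixes x s :: complex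
  assumes "x * s = 1"
  shows "s ^ 5 - x ^ 5 = ((x * x + s * s)\<^sup>2 + (x * x + s * s) + -1) * (s - x)"
proof -
  have "(x * x + s * s)\<^sup>2 = x ^ 4 + 2 * (x * s)\<^sup>2 + s ^ 4"
    by (simp add: eval_nat_numeral algebra_simps)
  then have sq: "(x * x + s * s)\<^sup>2 = x ^ 4 + 2 + s ^ 4"
    by (simp add: assms)
  have "((x * x + s * s)\<^sup>2 + (x * x + s * s) + -1) * (s - x) =
    s ^ 5 - x ^ 5 + x ^ 3 * (x * s) - s ^ 3 * (x * s) + s - x + x * (x * s) - x ^ 3 + s ^ 3 - s * (x * s)"
    unfolding sq by (simp add: eval_nat_numeral algebra_simps)
  then show ?thesis by (simp add: assms)
qed

text \<open>In terms of the square roots \<open>T\<close> the exponents, read from the last row, are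
  1, 5, 7, 11, 13, ..., so d = 6. The ratio of the second entry to the first is a^2 + a - 1, and a^2
  + a is the value of R at x = -(1 + a).\<close>

lemma so_char_eq:
  fixes t :: "nat \<Rightarrow> complex"
  defines "a \<equiv> \<lambda>i. t (Suc i) + inverse (t (Suc i))"
  assumes t: "\<And>i. i \<in> {1..N} \<Longrightarrow> t i \<noteq> 0" and den: "so_denom N t \<noteq> 0"
    and l: "\<And>c. c < N \<Longrightarrow> l (N - c) = (c + 1) div 2"
  shows "so_char N l t = alt_det N (\<lambda>i. (a i)\<^sup>2 + a i) (\<lambda>i. t (Suc i) ^ 3 + inverse (t (Suc i)) ^ 3) / vprod N a"
proof -
  define \<eta> where "\<eta> c = int (2 * ((c + 1) div 2 + c) + 1)" for c
  define T where "T i = t (Suc i) powr (1/2)" for i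
  let ?\<epsilon> = "(-1) ^ (N * (N - 1) div 2) :: complex"
  have T: "T i \<noteq> 0" "T i * T i = t (Suc i)" if "i < N" for i
    using t[of "Suc i"] that by (auto simp: T_def powr_add[symmetric])
  have den_eq: "so_denom N t = ?\<epsilon> * (\<Prod>i<N. skew_power 1 (T i)) * vprod N a"
    unfolding a_def T_def by (rule so_denom_eq) (use t in auto)
  have nz: "?\<epsilon> \<noteq> 0" "(\<Prod>i<N. skew_power 1 (T i)) \<noteq> 0" "vprod N a \<noteq> 0"
    using den unfolding den_eq by auto
  have half: "t (Suc j) powr (of_nat k + 1/2) = T j ^ (2 * k + 1)" if "j < N" for j k
  proof -
    have "t (Suc j) powr (of_nat k + 1/2) = t (Suc j) ^ k * T j"
      using t[of "Suc j"] that by (simp add: powr_add powr_nat T_def)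
    also have "t (Suc j) ^ k = T j ^ (2 * k)"
      using T[OF that] by (simp add: power_mult power2_eq_square)
    finally show ?thesis by simp
  qed
  have "det_upto N (\<lambda>i j. t j powr (- (of_nat (l i) + of_nat N - of_nat i + 1/2))
                       - t j powr (of_nat (l i) + of_nat N - of_nat i + 1/2)) =
    fdet N (\<lambda>i j. skew_power (\<eta> (N - 1 - i)) (T j))"
    unfolding det_upto_def fdet_def[symmetric]
  proof (rule fdet_cong)
    fix i j assume ij: "i < N" "j < N"
    define k where "k = l (Suc i) + (N - 1 - i)"
    have \<eta>: "\<eta> (N - 1 - i) = int (2 * k + 1)"
      using l[of "N - 1 - i"] ij by (simp add: \<eta>_def k_def)
    have "N = (N - 1 - i) + Suc i" using ij by simp
    then have "(of_nat N :: complex) = of_nat (N - 1 - i) + of_nat (Suc i)"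
      by (metis of_nat_add)
    then have "(of_nat (l (Suc i)) + of_nat N - of_nat (Suc i) + 1/2 :: complex) = of_nat k + 1/2"
      by (simp add: k_def)
    then show "t (Suc j) powr (- (of_nat (l (Suc i)) + of_nat N - of_nat (Suc i) + 1/2))
        - t (Suc j) powr (of_nat (l (Suc i)) + of_nat N - of_nat (Suc i) + 1/2) =
      skew_power (\<eta> (N - 1 - i)) (T j)"
      unfolding skew_power_def \<eta> power_int_minus power_int_of_nat
      using half[OF ij(2), of k] by (simp only: powr_minus)
  qed
  also have "\<dots> = ?\<epsilon> * fdet N (\<lambda>i c. skew_power (\<eta> c) (T i))"
    by (rule fdet_reverse_rows)
  also have "fdet N (\<lambda>i c. skew_power (\<eta> c) (T i)) = (\<Prod>i<N. skew_power 1 (T i)) *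
    alt_det N (\<lambda>i. (a i)\<^sup>2 + a i) (\<lambda>i. t (Suc i) ^ 3 + inverse (t (Suc i)) ^ 3)"
  proof (rule fdet_skew_power[where d = 6 and \<kappa> = "-1"])
    fix i assume i: "i < N"
    show nzT: "T i \<noteq> 0" by (rule T[OF i])
    show "skew_power 1 (T i) \<noteq> 0" using nz i by auto
    define s where "s = inverse (T i)"
    have s: "T i * s = 1" using nzT by (simp add: s_def)
    have ai: "a i = T i * T i + s * s" "inverse (t (Suc i)) = s * s"
      unfolding a_def T(2)[OF i, symmetric] by (simp_all add: s_def)
    have "\<eta> 1 = 5" by (simp add: \<eta>_def)
    then have "skew_power (\<eta> 1) (T i) = s ^ 5 - T i ^ 5" "skew_power 1 (T i) = s - T i"
      by (simp_all add: skew_power_def power_int_minus s_def power_inverse)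
    moreover have "s ^ 5 - T i ^ 5 = ((T i * T i + s * s)\<^sup>2 + (T i * T i + s * s) + -1) * (s - T i)"
      by (rule skew_power_5_identity[OF s])
    ultimately show "skew_power (\<eta> 1) (T i) = ((a i)\<^sup>2 + a i + -1) * skew_power 1 (T i)"
      by (simp add: ai)
    have "T i powi 6 + T i powi - 6 = T i ^ 6 + s ^ 6"
      by (simp add: power_int_minus s_def power_inverse)
    also have "\<dots> = (T i * T i) ^ 3 + (s * s) ^ 3"
      by (simp add: eval_nat_numeral)
    finally show "t (Suc i) ^ 3 + inverse (t (Suc i)) ^ 3 = T i powi 6 + T i powi - 6"
      by (simp add: ai T(2)[OF i])
  qed (simp_all add: \<eta>_def)
  finally show ?thesis
    unfolding so_char_def den_eq
    using nz by simp
qed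

section \<open>Nonvanishing in a punctured neighbourhood\<close>

lemma eventually_quadratic_nonzero:
  fixes a b c z :: complex
  assumes "a \<noteq> 0 \<or> b \<noteq> 0 \<or> c \<noteq> 0"
  shows "\<forall>\<^sub>F \<zeta> in at z. a + b * \<zeta> + c * \<zeta>\<^sup>2 \<noteq> 0"
proof -
  have "[:a, b, c:] \<noteq> 0" using assms by auto
  then have "finite {\<zeta>. poly [:a, b, c:] \<zeta> = 0}" by (rule poly_roots_finite)
  then have "\<forall>\<^sub>F \<zeta> in at z. \<forall>\<xi>\<in>{\<zeta>. poly [:a, b, c:] \<zeta> = 0}. \<zeta> \<noteq> \<xi>"
    by (rule eventually_ball_finite) (auto intro: eventually_neq_at_within)
  then show ?thesis
    by eventually_elim (auto simp: algebra_simps power2_eq_square)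
qed

text \<open>G is quadratic in \<zeta> with coefficients depending on x + x' and x x' only. They
  vanish simultaneously only for x = x' = 0.\<close>

lemma eventually_G_poly_nonzero:
  assumes "x \<noteq> x'"
  shows "\<forall>\<^sub>F \<zeta> in at z. G_poly \<zeta> x x' \<noteq> 0"
proof -
  let ?a = "2 * x * x' * (x + x' - 1)" and ?c = "2 * (x + x') - 2 * x * x'"
    and ?b = "x * x' * (x + x') - (x\<^sup>2 + x'\<^sup>2) - 6 * x * x' + (x + x')"
  have "?a \<noteq> 0 \<or> ?b \<noteq> 0 \<or> ?c \<noteq> 0"
  proof (rule ccontr)
    assume "\<not> ?thesis"
    then have a: "?a = 0" and b: "?b = 0" and c: "?c = 0" by auto
    show False
    proof (cases "x + x' = 1")
      case True
      then have "x * x' = 1" using c by (simp add: algebra_simps)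
      have "?b = x * x' * (x + x') - ((x + x')\<^sup>2 - 2 * (x * x')) - 6 * (x * x') + (x + x')"
        by (simp add: power2_eq_square algebra_simps)
      also have "\<dots> = - 3" unfolding True \<open>x * x' = 1\<close> by simp
      finally show False using b by simp
    next
      case False
      then have "x * x' = 0" "x + x' = 0" using a c by auto
      then show False using assms by auto
    qed
  qed
  from eventually_quadratic_nonzero[OF this, of z] show ?thesis
    by eventually_elim (simp add: G_poly_def algebra_simps power2_eq_square)
qed

text \<open>After clearing denominators a palindromic quadratic in \<zeta> remains. It may vanish at
  -2, so its coefficients are examined instead: the outer ones force y y' = y + y', and then the
  middle one equals y + y'.\<close>

lemma eventually_G_poly_nonzero_infinite:
  assumes "y \<noteq> 0" "y' \<noteq> 0"
  shows "\<forall>\<^sub>F \<zeta> in at (- 2). G_poly \<zeta> (\<zeta> * y / (\<zeta> + 2)) (\<zeta> * y' / (\<zeta> + 2)) \<noteq> 0"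
proof -
  let ?a = "2 * (y + y') - 2 * y * y'"
    and ?b = "y * y' * (y + y') - (y\<^sup>2 + y'\<^sup>2) - 6 * y * y' + 5 * (y + y')"
  have "?a \<noteq> 0 \<or> ?b \<noteq> 0 \<or> ?a \<noteq> 0"
  proof (rule ccontr)
    assume "\<not> ?thesis"
    then have "2 * (y * y') = 2 * (y + y')" and b: "?b = 0" by (simp_all add: algebra_simps)
    then have a: "y * y' = y + y'" by (metis mult_cancel_left zero_neq_numeral)
    have "?b = y * y' * (y + y') - ((y + y')\<^sup>2 - 2 * (y * y')) - 6 * (y * y') + 5 * (y + y')"
      by (simp add: power2_eq_square algebra_simps)
    also have "\<dots> = y + y'"
      unfolding a by (simp add: power2_eq_square algebra_simps)
    finally have "y + y' = ?b" by (rule sym)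
    then have "y + y' = 0" using b by (rule trans)
    then show False using a assms by simp
  qed
  note ev = eventually_quadratic_nonzero[OF this, of "- 2"]
  have "\<forall>\<^sub>F \<zeta> :: complex in at (- 2). \<zeta> \<noteq> 0" "\<forall>\<^sub>F \<zeta> :: complex in at (- 2). \<zeta> \<noteq> - 2"
    by (rule eventually_neq_at_within)+
  with ev show ?thesis
  proof eventually_elim
    case (elim \<zeta>)
    have e: "\<zeta> + 2 \<noteq> 0" using elim by (simp add: add_eq_0_iff2)
    have "(\<zeta> + 2)\<^sup>2 * G_poly \<zeta> (\<zeta> * y / (\<zeta> + 2)) (\<zeta> * y' / (\<zeta> + 2)) = \<zeta>\<^sup>2 * (?a + ?b * \<zeta> + ?a * \<zeta>\<^sup>2)"
    proof -
      define e where "e = \<zeta> + 2"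
      have z: "\<zeta> = e - 2" and "e \<noteq> 0" using e by (auto simp: e_def)
      have "e\<^sup>2 * G_poly \<zeta> (\<zeta> * y / e) (\<zeta> * y' / e) =
        \<zeta>\<^sup>2 * (\<zeta> * (y * y' * (y + y')) - \<zeta> * (y\<^sup>2 + y'\<^sup>2) - 2 * (\<zeta>\<^sup>2 + 3 * \<zeta> + 1) * (y * y') + (2 * \<zeta> + 1) * e * (y + y'))"
        using \<open>e \<noteq> 0\<close> by (simp add: G_poly_def field_simps power2_eq_square flip: e_def)
      also have "\<dots> = \<zeta>\<^sup>2 * (?a + ?b * \<zeta> + ?a * \<zeta>\<^sup>2)"
        unfolding e_def by (simp add: algebra_simps power2_eq_square)
      finally show ?thesis by (simp add: e_def)
    qed
    then show ?case using elim by auto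
  qed
qed

text \<open>Here the limit suffices: of the cleared expression only - \<zeta>^3 y^2 survives at -2,
  with value 8 y^2.\<close>

lemma eventually_G_poly_nonzero_mixed:
  assumes "y \<noteq> 0"
  shows "\<forall>\<^sub>F \<zeta> in at (- 2). G_poly \<zeta> x (\<zeta> * y / (\<zeta> + 2)) \<noteq> 0"
proof -
  let ?f = "\<lambda>\<zeta>. (\<zeta> + 2)\<^sup>2 * x\<^sup>2 * \<zeta> * y + (\<zeta> + 2) * x * \<zeta>\<^sup>2 * y\<^sup>2 - \<zeta> * ((\<zeta> + 2)\<^sup>2 * x\<^sup>2 + \<zeta>\<^sup>2 * y\<^sup>2)
    - 2 * (\<zeta>\<^sup>2 + 3 * \<zeta> + 1) * x * \<zeta> * y * (\<zeta> + 2) + \<zeta> * (2 * \<zeta> + 1) * ((\<zeta> + 2)\<^sup>2 * x + \<zeta> * y * (\<zeta> + 2))"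
  have "(?f \<longlongrightarrow> ?f (- 2)) (at (- 2))"
    by (intro tendsto_intros)
  moreover have "?f (- 2) \<noteq> 0" using assms by simp
  ultimately have "\<forall>\<^sub>F \<zeta> in at (- 2). ?f \<zeta> \<noteq> 0"
    by (rule tendsto_imp_eventually_ne)
  moreover have "\<forall>\<^sub>F \<zeta> :: complex in at (- 2). \<zeta> \<noteq> - 2"
    by (rule eventually_neq_at_within)
  ultimately show ?thesis
  proof eventually_elim
    case (elim \<zeta>)
    define e where "e = \<zeta> + 2"
    have "e \<noteq> 0" using elim by (simp add: e_def add_eq_0_iff2)
    have "?f \<zeta> = e\<^sup>2 * G_poly \<zeta> x (\<zeta> * y / e)"
      using \<open>e \<noteq> 0\<close> unfolding G_poly_def e_def[symmetric] by (simp add: field_simps power2_eq_square)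
    then show ?case using elim by (auto simp: e_def)
  qed
qed

section \<open>The limit\<close>

text \<open>The leading coefficient at the pole: Q tends to -2 (y - 1), while R and P, multiplied by
  the second and third power of \<zeta> + 2, tend to 4 y^2 and -8 y^3.\<close>

definition S_col_top :: "nat \<Rightarrow> nat \<Rightarrow> complex \<Rightarrow> complex" where
  "S_col_top n c y = (- 2 * (y - 1)) ^ (n - c mod 2 - c div 2) * (4 * y\<^sup>2) ^ (c mod 2) * (- 8 * y ^ 3) ^ (c div 2)"

text \<open>R has a double and P a triple pole at the infinite arguments, whereas Q takes the finite
  value \<zeta> (y - 1) there.\<close>

definition col_order :: "nat \<Rightarrow> nat" where
  "col_order c = 2 * (c mod 2) + 3 * (c div 2)"

lemma col_order_eq: "col_order c = c + (c + 1) div 2"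
  unfolding col_order_def by (cases "even c") (auto elim!: evenE oddE)

lemma col_order_less: "c < d \<Longrightarrow> col_order c < col_order d"
  unfolding col_order_eq by (intro add_less_le_mono div_le_mono) auto

lemma col_order_mono: "c \<le> d \<Longrightarrow> col_order c \<le> col_order d"
  using col_order_less[of c d] by (cases "c = d") auto

lemma tendsto_S_col:
  "((\<lambda>\<zeta>. S_col \<zeta> n c x) \<longlongrightarrow> S_col (- 2) n c x) (at (- 2))"
  unfolding S_col_def P_poly_def Q_poly_def by (intro tendsto_intros)

lemma tendsto_S_col_top:
  "((\<lambda>\<zeta>. (\<zeta> + 2) ^ col_order c * S_col \<zeta> n c (\<zeta> * y / (\<zeta> + 2))) \<longlongrightarrow> S_col_top n c y) (at (- 2))"
proof (rule Lim_transform_eventually)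
  let ?f = "\<lambda>\<zeta>. (\<zeta> * (y - 1)) ^ (n - c mod 2 - c div 2) * (\<zeta> * y * (\<zeta> * y + (\<zeta> + 2))) ^ (c mod 2)
    * ((\<zeta> * y)\<^sup>2 * (\<zeta> * y - (\<zeta> + 2) * (2 * \<zeta> + 1))) ^ (c div 2)"
  have "(?f \<longlongrightarrow> ?f (- 2)) (at (- 2))"
    by (intro tendsto_intros)
  also have "?f (- 2) = S_col_top n c y"
  proof -
    have "(- 2 * y)\<^sup>2 * (- 2 * y - (- 2 + 2) * (2 * - 2 + 1)) = - 8 * y ^ 3"
      "- 2 * y * (- 2 * y + (- 2 + 2)) = 4 * y\<^sup>2"
      by (simp_all add: power2_eq_square power3_eq_cube)
    then show ?thesis unfolding S_col_top_def by (simp only:)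
  qed
  finally show "(?f \<longlongrightarrow> S_col_top n c y) (at (- 2))" .
  have "?f \<zeta> = (\<zeta> + 2) ^ col_order c * S_col \<zeta> n c (\<zeta> * y / (\<zeta> + 2))" if "\<zeta> \<noteq> - 2" for \<zeta>
  proof -
    define e where "e = \<zeta> + 2"
    have e: "e \<noteq> 0" using that by (simp add: e_def add_eq_0_iff2)
    have Q: "Q_poly \<zeta> (\<zeta> * y / e) = \<zeta> * (y - 1)"
      using e by (simp add: Q_poly_def field_simps flip: e_def)
    have R: "e\<^sup>2 * R_poly (\<zeta> * y / e) = \<zeta> * y * (\<zeta> * y + e)"
      using e by (simp add: R_poly_def field_simps power2_eq_square)
    have P: "e ^ 3 * P_poly \<zeta> (\<zeta> * y / e) = (\<zeta> * y)\<^sup>2 * (\<zeta> * y - e * (2 * \<zeta> + 1))"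
      using e by (simp add: P_poly_def field_simps power2_eq_square power3_eq_cube)
    have "e ^ col_order c = (e\<^sup>2) ^ (c mod 2) * (e ^ 3) ^ (c div 2)"
      by (simp add: col_order_def power_add power_mult)
    then show ?thesis
      unfolding e_def[symmetric] S_col_def Q R[symmetric] P[symmetric]
      by (simp only: power_mult_distrib mult_ac)
  qed
  then show "\<forall>\<^sub>F \<zeta> in at (- 2). ?f \<zeta> = (\<zeta> + 2) ^ col_order c * S_col \<zeta> n c (\<zeta> * y / (\<zeta> + 2))"
    by (auto simp: eventually_at_filter)
qed

definition join0 :: "nat \<Rightarrow> (nat \<Rightarrow> complex) \<Rightarrow> (nat \<Rightarrow> complex) \<Rightarrow> complex \<Rightarrow> nat \<Rightarrow> complex" where
  "join0 p x y \<zeta> i = (if i < p then x i else \<zeta> * y (i - p) / (\<zeta> + 2))"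

text \<open>
  After the powers of \<open>\<zeta> + 2\<close> are distributed over rows and columns, all entries converge, and
  the entries in the first \<open>p\<close> rows and last \<open>q\<close> columns tend to \<open>0\<close>.
\<close>

lemma tendsto_fdet_S_col:
  "((\<lambda>\<zeta>. (\<zeta> + 2) ^ (\<Sum>c<q. col_order (p + c)) * fdet (p + q) (\<lambda>i c. S_col \<zeta> n c (join0 p x y \<zeta> i)))
    \<longlongrightarrow> fdet p (\<lambda>i c. S_col (- 2) n c (x i)) * fdet q (\<lambda>i c. S_col_top n (p + c) (y i))) (at (- 2))"
proof -
  \<comment> \<open>The order of the last column kept by the finite arguments. Rows of infinite
    arguments are scaled by the power s and column c \<ge> p by its order minus s, so together they
    receive exactly its order. For p = 0 no column has to be dominated.\<close>
  define s where "s = (if p = 0 then 0 else col_order (p - 1))"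
  define d where "d c = (if c < p then 0 else col_order c - s)" for c
  define \<rho> where "\<rho> i = (if i < p then 0 else s)" for i
  have s_less: "p \<noteq> 0 \<Longrightarrow> s < col_order c" "s \<le> col_order c" if "p \<le> c" for c
  proof -
    show *: "s < col_order c" if "p \<noteq> 0"
      using that \<open>p \<le> c\<close> col_order_less[of "p - 1" c] by (simp add: s_def)
    show "s \<le> col_order c"
      using * by (cases "p = 0") (auto simp: s_def)
  qed
  have s_ge: "col_order c \<le> s" if "c < p" for c
    using that col_order_mono[of c "p - 1"] by (simp add: s_def)
  define M where "M \<zeta> i c = (\<zeta> + 2) ^ \<rho> i * ((\<zeta> + 2) ^ d c * S_col \<zeta> n c (join0 p x y \<zeta> i))" for \<zeta> i c
  define L where "L i c = (if i < p then if c < p then S_col (- 2) n c (x i) else 0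
    else if c < p then 0 ^ (s - col_order c) * S_col_top n c (y (i - p)) else S_col_top n c (y (i - p)))" for i c
  have "((\<lambda>\<zeta>. fdet (p + q) (M \<zeta>)) \<longlongrightarrow> fdet (p + q) L) (at (- 2))"
  proof (rule tendsto_fdet)
    fix i c
    have e0: "((\<lambda>\<zeta> :: complex. (\<zeta> + 2) ^ k) \<longlongrightarrow> 0 ^ k) (at (- 2))" for k
      by (rule tendsto_eq_intros refl | simp)+
    show "((\<lambda>\<zeta>. M \<zeta> i c) \<longlongrightarrow> L i c) (at (- 2))"
    proof (cases "i < p")
      case True
      have *: "M \<zeta> i c = (\<zeta> + 2) ^ d c * S_col \<zeta> n c (x i)" for \<zeta>
        using True by (simp add: M_def \<rho>_def join0_def)
      have "((\<lambda>\<zeta>. M \<zeta> i c) \<longlongrightarrow> 0 ^ d c * S_col (- 2) n c (x i)) (at (- 2))"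
        unfolding * by (intro tendsto_mult e0 tendsto_S_col)
      moreover have "0 ^ d c * S_col (- 2) n c (x i) = L i c"
        using True s_less(1)[of c] by (auto simp: L_def d_def)
      ultimately show ?thesis by simp
    next
      case False
      have "M \<zeta> i c = (\<zeta> + 2) ^ (s + d c - col_order c) *
        ((\<zeta> + 2) ^ col_order c * S_col \<zeta> n c (\<zeta> * y (i - p) / (\<zeta> + 2)))" for \<zeta>
      proof -
        have "s + d c = (s + d c - col_order c) + col_order c"
          using s_less(2)[of c] s_ge[of c] by (cases "c < p") (auto simp: d_def)
        then have "(\<zeta> + 2) ^ (s + d c) = (\<zeta> + 2) ^ (s + d c - col_order c) * (\<zeta> + 2) ^ col_order c"
          by (metis power_add)
        then show ?thesis
          using False by (simp add: M_def \<rho>_def join0_def power_add)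
      qed
      then have "((\<lambda>\<zeta>. M \<zeta> i c) \<longlongrightarrow> 0 ^ (s + d c - col_order c) * S_col_top n c (y (i - p))) (at (- 2))"
        by (simp only:) (intro tendsto_mult e0 tendsto_S_col_top)
      moreover have "0 ^ (s + d c - col_order c) * S_col_top n c (y (i - p)) = L i c"
        using False s_less(2)[of c] by (auto simp: L_def d_def)
      ultimately show ?thesis by simp
    qed
  qed
  moreover have "fdet (p + q) L = fdet p L * fdet q (\<lambda>i j. L (p + i) (p + j))"
    by (rule fdet_block) (simp add: L_def)
  moreover have "fdet p L = fdet p (\<lambda>i c. S_col (- 2) n c (x i))"
    by (rule fdet_cong) (simp add: L_def)
  moreover have "fdet q (\<lambda>i j. L (p + i) (p + j)) = fdet q (\<lambda>i c. S_col_top n (p + c) (y i))"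
    by (rule fdet_cong) (simp add: L_def)
  moreover have "fdet (p + q) (M \<zeta>) = (\<zeta> + 2) ^ (\<Sum>c<q. col_order (p + c)) *
    fdet (p + q) (\<lambda>i c. S_col \<zeta> n c (join0 p x y \<zeta> i))" for \<zeta>
  proof -
    have "fdet (p + q) (M \<zeta>) = (\<Prod>i<p + q. (\<zeta> + 2) ^ \<rho> i) * ((\<Prod>c<p + q. (\<zeta> + 2) ^ d c) *
      fdet (p + q) (\<lambda>i c. S_col \<zeta> n c (join0 p x y \<zeta> i)))"
      unfolding M_def by (simp only: fdet_scale_rows fdet_scale_cols)
    also have "(\<Prod>i<p + q. (\<zeta> + 2) ^ \<rho> i) = (\<zeta> + 2) ^ (\<Sum>c<q. s)"
      unfolding prod_lessThan_add power_sum by (simp add: \<rho>_def)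
    also have "(\<Prod>c<p + q. (\<zeta> + 2) ^ d c) = (\<zeta> + 2) ^ (\<Sum>c<q. col_order (p + c) - s)"
      by (simp add: prod_lessThan_add d_def power_sum)
    finally have "fdet (p + q) (M \<zeta>) = (\<zeta> + 2) ^ ((\<Sum>c<q. s) + (\<Sum>c<q. col_order (p + c) - s)) *
      fdet (p + q) (\<lambda>i c. S_col \<zeta> n c (join0 p x y \<zeta> i))"
      by (simp add: power_add)
    also have "(\<Sum>c<q. s) + (\<Sum>c<q. col_order (p + c) - s) = (\<Sum>c<q. col_order (p + c))"
      unfolding sum.distrib[symmetric] using s_less(2) by (intro sum.cong) auto
    finally show ?thesis .
  qed
  ultimately show ?thesis by simp
qed

text \<open>A difference involving an infinite argument has a simple pole, and the one with index i
  meets p finite and i earlier infinite arguments.\<close>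

lemma tendsto_vprod:
  "((\<lambda>\<zeta>. (\<zeta> + 2) ^ (\<Sum>i<q. p + i) * vprod (p + q) (join0 p x y \<zeta>))
    \<longlongrightarrow> vprod p x * ((\<Prod>i<q. (- 2) ^ (p + i) * y i ^ p) * vprod q y)) (at (- 2))"
proof (rule Lim_transform_eventually)
  let ?f = "\<lambda>\<zeta>. vprod p x * (\<Prod>i<q. (\<Prod>j<p. \<zeta> * y i - (\<zeta> + 2) * x j) * (\<Prod>j<i. \<zeta> * (y i - y j)))"
  have "(?f \<longlongrightarrow> ?f (- 2)) (at (- 2))"
    by (intro tendsto_intros)
  also have "?f (- 2) = vprod p x * ((\<Prod>i<q. (- 2) ^ (p + i) * y i ^ p) * vprod q y)"
  proof -
    have "(\<Prod>j<p. - 2 * y i - (- 2 + 2) * x j) * (\<Prod>j<i. - 2 * (y i - y j)) =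
      (- 2) ^ (p + i) * y i ^ p * (\<Prod>j<i. y i - y j)" for i
      by (simp only: prod.distrib) (simp add: power_add power_mult_distrib[of "-2" "y i", simplified])
    then show ?thesis by (simp only: prod.distrib vprod_def)
  qed
  finally show "(?f \<longlongrightarrow> vprod p x * ((\<Prod>i<q. (- 2) ^ (p + i) * y i ^ p) * vprod q y)) (at (- 2))" .
  have "?f \<zeta> = (\<zeta> + 2) ^ (\<Sum>i<q. p + i) * vprod (p + q) (join0 p x y \<zeta>)" if "\<zeta> \<noteq> - 2" for \<zeta>
  proof -
    define e where "e = \<zeta> + 2"
    have e: "e \<noteq> 0" using that by (simp add: e_def add_eq_0_iff2)
    let ?w = "join0 p x y \<zeta>"
    have "vprod (p + q) ?w = vprod p ?w * (\<Prod>i<q. (\<Prod>j<p. ?w (p + i) - ?w j) * (\<Prod>j<i. ?w (p + i) - ?w (p + j)))"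
      by (simp add: vprod_def prod_lessThan_add)
    also have "vprod p ?w = vprod p x"
      by (rule vprod_cong) (simp add: join0_def)
    finally have "e ^ (\<Sum>i<q. p + i) * vprod (p + q) ?w = vprod p x *
      (\<Prod>i<q. e ^ (p + i) * ((\<Prod>j<p. ?w (p + i) - ?w j) * (\<Prod>j<i. ?w (p + i) - ?w (p + j))))"
      by (simp add: prod.distrib power_sum)
    also have "(\<Prod>i<q. e ^ (p + i) * ((\<Prod>j<p. ?w (p + i) - ?w j) * (\<Prod>j<i. ?w (p + i) - ?w (p + j)))) =
      (\<Prod>i<q. (\<Prod>j<p. \<zeta> * y i - e * x j) * (\<Prod>j<i. \<zeta> * (y i - y j)))"
    proof (intro prod.cong refl)
      fix i
      have "e ^ (p + i) * ((\<Prod>j<p. ?w (p + i) - ?w j) * (\<Prod>j<i. ?w (p + i) - ?w (p + j))) =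
        (\<Prod>j<p. e * (?w (p + i) - ?w j)) * (\<Prod>j<i. e * (?w (p + i) - ?w (p + j)))"
        by (simp add: prod.distrib power_add)
      also have "(\<Prod>j<p. e * (?w (p + i) - ?w j)) = (\<Prod>j<p. \<zeta> * y i - e * x j)"
        using e by (intro prod.cong refl) (simp add: join0_def field_simps flip: e_def)
      also have "(\<Prod>j<i. e * (?w (p + i) - ?w (p + j))) = (\<Prod>j<i. \<zeta> * (y i - y j))"
        using e by (intro prod.cong refl) (simp add: join0_def field_simps flip: e_def)
      finally show "e ^ (p + i) * ((\<Prod>j<p. ?w (p + i) - ?w j) * (\<Prod>j<i. ?w (p + i) - ?w (p + j))) =
        (\<Prod>j<p. \<zeta> * y i - e * x j) * (\<Prod>j<i. \<zeta> * (y i - y j))" .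
    qed
    finally show ?thesis by (simp add: e_def)
  qed
  then show "\<forall>\<^sub>F \<zeta> in at (- 2). ?f \<zeta> = (\<zeta> + 2) ^ (\<Sum>i<q. p + i) * vprod (p + q) (join0 p x y \<zeta>)"
    by (auto simp: eventually_at_filter)
qed

text \<open>Counting columns from the last one and extracting the n-th power of the coefficient of P
  leaves R/P = -1/(2 y) and Q/P = (y - 1)/(4 y^3) in place of R/Q and P/Q.\<close>

lemma S_col_top_eq:
  assumes y: "y \<noteq> 0" and d: "d \<le> 2 * n"
  shows "S_col_top n (2 * n - d) y =
    (- 8 * y ^ 3) ^ n * ((- 1 / (2 * y)) ^ (d mod 2) * ((y - 1) / (4 * y ^ 3)) ^ (d div 2))"
proof -
  define l where "l = d div 2"
  define A where "A = - 8 * y ^ 3"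
  have A: "A \<noteq> 0" using y by (simp add: A_def)
  have H: "(y - 1) / (4 * y ^ 3) = - 2 * (y - 1) / A" using y by (simp add: A_def field_simps)
  show ?thesis
  proof (cases "even d")
    case True
    then have "d = 2 * l" by (simp add: l_def)
    moreover have "(2 * n - 2 * l) mod 2 = 0" "(2 * n - 2 * l) div 2 = n - l"
      by (simp_all add: diff_mult_distrib2[symmetric])
    moreover have "l \<le> n" using d \<open>d = 2 * l\<close> by simp
    moreover have "A ^ n = A ^ (n - l) * A ^ l" using \<open>l \<le> n\<close> by (simp flip: power_add)
    ultimately show ?thesis
      using A unfolding S_col_top_def A_def[symmetric] H by (simp add: power_divide field_simps)
  next
    case False
    then have dl: "d = 2 * l + 1" by (simp add: l_def)
    then have ln: "l < n" using d by simp
    then have "2 * n - d = 2 * (n - l - 1) + 1" using dl by simp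
    then have "(2 * n - d) mod 2 = 1" "(2 * n - d) div 2 = n - l - 1" by auto
    moreover have "n - 1 - (n - l - 1) = l" using ln by simp
    moreover have "A ^ n = A ^ (n - l - 1) * A ^ l * A"
      using ln by (simp flip: power_add power_Suc2)
    moreover have "A * (- 1 / (2 * y)) = 4 * y\<^sup>2"
      using y by (simp add: A_def power2_eq_square power3_eq_cube field_simps)
    moreover have "d mod 2 = 1" "d div 2 = l" using dl by auto
    moreover have "N ^ l * (A * r) * A ^ (n - l - 1) = A ^ (n - l - 1) * A ^ l * A * (r * (N / A) ^ l)" for N r
      using A by (simp add: power_divide)
    ultimately show ?thesis
      unfolding S_col_top_def A_def[symmetric] H by (metis power_one_right)
  qed
qed

section \<open>The limiting alternants and Vandermonde products in terms of t and u\<close>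

lemma cube_add_inverse:
  fixes x s :: complex
  assumes "x * s = 1"
  shows "(x + s) ^ 3 = x ^ 3 + s ^ 3 + 3 * (x + s)"
proof -
  have "(x + s) ^ 3 = x ^ 3 + s ^ 3 + 3 * (x * s) * (x + s)"
    by (simp add: power3_eq_cube algebra_simps)
  then show ?thesis by (simp add: assms)
qed

lemma fdet_S_col_bottom:
  fixes t :: "nat \<Rightarrow> complex"
  defines "a \<equiv> \<lambda>i. t i + inverse (t i)"
  assumes t: "\<And>i. i < p \<Longrightarrow> t i \<noteq> 0"
  shows "fdet p (\<lambda>i c. S_col (- 2) n c (x_of (t i))) =
    (\<Prod>c<p. 2 ^ (n - c mod 2 - c div 2) * (- 1) ^ (c div 2)) *
    alt_det p (\<lambda>i. (a i)\<^sup>2 + a i) (\<lambda>i. t i ^ 3 + inverse (t i) ^ 3)"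
proof -
  let ?C = "\<lambda>i. t i ^ 3 + inverse (t i) ^ 3"
  have "fdet p (\<lambda>i c. S_col (- 2) n c (x_of (t i))) =
    fdet p (\<lambda>i c. 2 ^ (n - c mod 2 - c div 2) * (((a i)\<^sup>2 + a i) ^ (c mod 2) * (- 1 * (?C i + - 2)) ^ (c div 2)))"
  proof (rule fdet_cong)
    fix i c assume "i < p"
    then have "t i * inverse (t i) = 1" using t by simp
    then have cube: "(a i) ^ 3 = ?C i + 3 * a i"
      unfolding a_def by (rule cube_add_inverse)
    have x: "x_of (t i) = - (1 + a i)" by (simp add: x_of_def a_def)
    have "Q_poly (- 2) (x_of (t i)) = 2" by (simp add: Q_poly_def)
    moreover have "R_poly (x_of (t i)) = (a i)\<^sup>2 + a i"
      by (simp add: x R_poly_def power2_eq_square algebra_simps)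
    moreover have "P_poly (- 2) (x_of (t i)) = - (a i ^ 3) + 3 * a i + 2"
      by (simp add: x P_poly_def power2_eq_square power3_eq_cube algebra_simps)
    then have "P_poly (- 2) (x_of (t i)) = - 1 * (?C i + - 2)"
      unfolding cube by simp
    ultimately show "S_col (- 2) n c (x_of (t i)) =
      2 ^ (n - c mod 2 - c div 2) * (((a i)\<^sup>2 + a i) ^ (c mod 2) * (- 1 * (?C i + - 2)) ^ (c div 2))"
      by (simp only: S_col_def mult.assoc)
  qed
  also have "\<dots> = (\<Prod>c<p. 2 ^ (n - c mod 2 - c div 2)) *
    alt_det p (\<lambda>i. 1 * ((a i)\<^sup>2 + a i)) (\<lambda>i. - 1 * (?C i + - 2))"
    by (simp only: fdet_scale_cols alt_det_def mult_1)
  also have "alt_det p (\<lambda>i. 1 * ((a i)\<^sup>2 + a i)) (\<lambda>i. - 1 * (?C i + - 2)) =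
    (\<Prod>c<p. 1 ^ (c mod 2) * (- 1) ^ (c div 2)) * alt_det p (\<lambda>i. ((a i)\<^sup>2 + a i) + 0) (\<lambda>i. ?C i + - 2)"
    by (simp only: alt_det_scale add_0_right)
  also have "alt_det p (\<lambda>i. ((a i)\<^sup>2 + a i) + 0) (\<lambda>i. ?C i + - 2) = alt_det p (\<lambda>i. (a i)\<^sup>2 + a i) ?C"
    by (rule alt_det_translate)
  finally show ?thesis by (simp add: prod.distrib)
qed

text \<open>The substitution for y makes Q/P the same cubic as for the finite arguments: it is P at
  \<zeta> = -2, evaluated at -3/y = -(1 + b), divided by 108.\<close>

lemma fdet_S_col_top:
  fixes u :: "nat \<Rightarrow> complex"
  defines "b \<equiv> \<lambda>i. u i + inverse (u i)"
  assumes pq: "p + q = 2 * n + 1"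
    and u: "\<And>i. i < q \<Longrightarrow> u i \<noteq> 0" "\<And>i. i < q \<Longrightarrow> 1 + b i \<noteq> 0"
  shows "fdet q (\<lambda>i c. S_col_top n (p + c) (y_of (u i))) =
    (\<Prod>c<q. (- 1) ^ c) * (\<Prod>i<q. (- 8 * y_of (u i) ^ 3) ^ n) *
    (\<Prod>c<q. (- 1 / 6) ^ (c mod 2) * (- 1 / 108) ^ (c div 2)) *
    alt_det q (\<lambda>i. 1 + b i) (\<lambda>i. u i ^ 3 + inverse (u i) ^ 3)"
proof -
  let ?C = "\<lambda>i. u i ^ 3 + inverse (u i) ^ 3"
  let ?B = "\<lambda>i d. (- 8 * y_of (u i) ^ 3) ^ n *
      ((- 1 / 6 * (1 + b i)) ^ (d mod 2) * (- 1 / 108 * (?C i + - 2)) ^ (d div 2))"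
  have "fdet q (\<lambda>i c. S_col_top n (p + c) (y_of (u i))) = fdet q (\<lambda>i c. ?B i (q - 1 - c))"
  proof (rule fdet_cong)
    fix i c assume i: "i < q" and c: "c < q"
    define y where "y = y_of (u i)"
    have "u i * inverse (u i) = 1" using u i by simp
    then have cube: "?C i = (b i) ^ 3 - 3 * b i"
      using cube_add_inverse[of "u i" "inverse (u i)"] unfolding b_def by simp
    have y: "y = 3 / (1 + b i)" by (simp add: y_def y_of_def b_def add.assoc)
    have nz: "1 + b i \<noteq> 0" "y \<noteq> 0" using u(2)[OF i] by (auto simp: y)
    have "- 1 / (2 * (3 / B)) = - 1 / 6 * B" if "B \<noteq> 0" for B :: complex
      using that by (simp add: field_simps)
    then have 1: "- 1 / (2 * y) = - 1 / 6 * (1 + b i)" unfolding y using nz(1) by blast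
    have "(3 / B - 1) / (4 * (3 / B) ^ 3) = (3 - B) * B\<^sup>2 / 108" if "B \<noteq> 0" for B :: complex
      using that by (simp add: field_simps power2_eq_square power3_eq_cube)
    then have "(y - 1) / (4 * y ^ 3) = (3 - (1 + b i)) * (1 + b i)\<^sup>2 / 108"
      unfolding y using nz(1) by blast
    also have "\<dots> = - 1 / 108 * (?C i + - 2)"
      unfolding cube by (simp add: power2_eq_square power3_eq_cube field_simps)
    finally have 2: "(y - 1) / (4 * y ^ 3) = - 1 / 108 * (?C i + - 2)" .
    have idx: "p + c = 2 * n - (q - 1 - c)" "q - 1 - c \<le> 2 * n" using pq c by auto
    show "S_col_top n (p + c) (y_of (u i)) = ?B i (q - 1 - c)"
      using S_col_top_eq[OF nz(2) idx(2)] 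
      unfolding 1 2 idx(1)[symmetric] unfolding y_def .
  qed
  also have "\<dots> = (\<Prod>c<q. (- 1) ^ c) * fdet q ?B"
    unfolding minus_one_power_triangular[symmetric] by (rule fdet_reverse_cols)
  also have "fdet q ?B = (\<Prod>i<q. (- 8 * y_of (u i) ^ 3) ^ n) *
    alt_det q (\<lambda>i. - 1 / 6 * (1 + b i)) (\<lambda>i. - 1 / 108 * (?C i + - 2))"
    by (simp only: fdet_scale_rows alt_det_def)
  also have "alt_det q (\<lambda>i. - 1 / 6 * (1 + b i)) (\<lambda>i. - 1 / 108 * (?C i + - 2)) =
    (\<Prod>c<q. (- 1 / 6) ^ (c mod 2) * (- 1 / 108) ^ (c div 2)) * alt_det q (\<lambda>i. (1 + b i) + 0) (\<lambda>i. ?C i + - 2)"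
    by (simp only: alt_det_scale add_0_right)
  also have "alt_det q (\<lambda>i. (1 + b i) + 0) (\<lambda>i. ?C i + - 2) = alt_det q (\<lambda>i. 1 + b i) ?C"
    by (rule alt_det_translate)
  finally show ?thesis by (simp only: mult.assoc)
qed

lemma vprod_x_of:
  "vprod p (\<lambda>i. x_of (t i)) = (\<Prod>c<p. (- 1) ^ c) * vprod p (\<lambda>i. t i + inverse (t i))"
proof -
  have "vprod p (\<lambda>i. x_of (t i)) =
    (\<Prod>i<p. \<Prod>j<i. (- 1) * ((t i + inverse (t i)) - (t j + inverse (t j))))"
    unfolding vprod_def x_of_def by (intro prod.cong refl) simp
  then show ?thesis by (simp only: prod.distrib vprod_def) simp
qed

text \<open>For y = 3/(1 + b) one has y_i - y_j = -(1/3) y_i y_j (b_i - b_j), and each y_i lies in q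
  - 1 pairs.\<close>

lemma vprod_y_of:
  assumes "\<And>i. i < q \<Longrightarrow> 1 + u i + inverse (u i) \<noteq> 0"
  shows "vprod q (\<lambda>i. y_of (u i)) = (\<Prod>c<q. (- 1 / 3) ^ c) * (\<Prod>i<q. y_of (u i) ^ (q - 1)) *
    vprod q (\<lambda>i. u i + inverse (u i))"
proof -
  have "vprod q (\<lambda>i. y_of (u i)) = (\<Prod>i<q. \<Prod>j<i. (- 1 / 3) * ((y_of (u j) * y_of (u i)) *
    ((u i + inverse (u i)) - (u j + inverse (u j)))))"
    unfolding vprod_def
  proof (intro prod.cong refl)
    fix i j assume "i \<in> {..<q}" "j \<in> {..<i}"
    then have "1 + u i + inverse (u i) \<noteq> 0" "1 + u j + inverse (u j) \<noteq> 0" using assms by auto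
    moreover have "3 / B - 3 / A = (- 1 / 3) * ((3 / A * (3 / B)) * ((B - 1) - (A - 1)))"
      if "A \<noteq> 0" "B \<noteq> 0" for A B :: complex
      using that by (simp add: field_simps)
    ultimately have "y_of (u i) - y_of (u j) = (- 1 / 3) * ((y_of (u j) * y_of (u i)) *
      ((1 + u i + inverse (u i) - 1) - (1 + u j + inverse (u j) - 1)))"
      unfolding y_of_def by blast
    then show "y_of (u i) - y_of (u j) = (- 1 / 3) * ((y_of (u j) * y_of (u i)) *
      ((u i + inverse (u i)) - (u j + inverse (u j))))" by (simp add: add.assoc)
  qed
  then show ?thesis
    unfolding prod_pairs_mult[symmetric] vprod_def by (simp only: prod.distrib) simp
qed

text \<open>The constant as it arises. The first product joins the scalings at the finite arguments
  with the sign of their Vandermonde product. In the second, the numerator holds the reversal sign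
  and the scalings by -1/6 and -1/108, the denominator the Vandermonde factors. The power of -24
  comes from the factors -8 y with y = 3/(1 + b).\<close>

definition limit_const :: "nat \<Rightarrow> nat \<Rightarrow> nat \<Rightarrow> complex" where
  "limit_const p q n = (\<Prod>c<p. 2 ^ (n - c mod 2 - c div 2) * (- 1) ^ (c div 2) * (- 1) ^ c) *
    (\<Prod>c<q. (- 1) ^ c * (- 1 / 6) ^ (c mod 2) * (- 1 / 108) ^ (c div 2) / ((- 2) ^ (p + c) * (- 1 / 3) ^ c)) *
    (- 24) ^ (n * q)"

text \<open>Both parities of q are treated at once. Read from the last part, the partitions are
  always 0, 1, 1, 2, 2, ... for the t_i and 0, 0, 1, 1, ... for the u_i. The exponent of \<zeta> + 2
  sums the differences between the order of column p + c and p + c.\<close>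

proposition S_poly_limit:
  assumes pq: "p + q = 2 * n + 1" and reg: "regular_point p q t u"
    and l: "\<And>c. c < p \<Longrightarrow> l (p - c) = (c + 1) div 2"
    and l': "\<And>c. c < q \<Longrightarrow> l' (q - c) = c div 2"
  shows "((\<lambda>\<zeta>. (\<zeta> + 2) ^ (\<Sum>c<q. (p + c + 1) div 2) *
      S_poly n \<zeta> (join_args p (\<lambda>i. x_of (t i)) (\<lambda>i. \<zeta> * y_of (u i) / (\<zeta> + 2))))
    \<longlongrightarrow> limit_const p q n * (\<Prod>i=1..q. 1 / (1 + u i + inverse (u i)) ^ n) *
      so_char p l t * sp_char q l' u) (at (- 2))"
proof -
  define x where "x i = x_of (t (Suc i))" for i
  define y where "y i = y_of (u (Suc i))" for i
  define a where "a i = t (Suc i) + inverse (t (Suc i))" for i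
  define b where "b i = u (Suc i) + inverse (u (Suc i))" for i
  define v where "v \<zeta> = join_args p (\<lambda>i. x_of (t i)) (\<lambda>i. \<zeta> * y_of (u i) / (\<zeta> + 2))" for \<zeta>
  let ?w = "join0 p x y"
  have t0: "\<And>i. i \<in> {1..p} \<Longrightarrow> t i \<noteq> 0" and u0: "\<And>i. i \<in> {1..q} \<Longrightarrow> u i \<noteq> 0"
    and u1: "\<And>i. i \<in> {1..q} \<Longrightarrow> 1 + u i + inverse (u i) \<noteq> 0"
    and so: "so_denom p t \<noteq> 0" and sp: "sp_denom q u \<noteq> 0"
    using reg unfolding regular_point_def by blast+
  have v_w: "v \<zeta> (Suc i) = ?w \<zeta> i" for \<zeta> i
    by (auto simp: v_def join_args_def join0_def x_def y_def Suc_diff_le)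
  have va: "vprod p a \<noteq> 0"
    using so so_denom_eq[of p t] t0 unfolding a_def by auto
  have vb: "vprod q b \<noteq> 0" and sk: "(\<Prod>i<q. skew_power 1 (u (Suc i))) \<noteq> 0"
    using sp sp_denom_eq[of q u] u0 unfolding b_def by auto
  have y_eq: "y i = 3 / (1 + b i)" for i by (simp add: y_def y_of_def b_def add.assoc)
  have b1: "1 + b i \<noteq> 0" if "i < q" for i
    using u1[of "Suc i"] that by (simp add: b_def add.assoc)
  have y0: "y i \<noteq> 0" if "i < q" for i using b1[OF that] by (simp add: y_eq)
  \<comment> \<open>Q at the infinite argument is \<zeta> (y - 1), so y = 1 has to be excluded; it
    would mean u = 1, a zero of the symplectic denominator.\<close>
  have y1: "y i \<noteq> 1" if "i < q" for i
  proof
    assume "y i = 1"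
    then have "b i = 2" using b1[OF that] by (simp add: y_eq)
    moreover have un: "u (Suc i) \<noteq> 0" using u0 that by auto
    ultimately have "(u (Suc i) - 1)\<^sup>2 = 0"
      by (simp add: b_def field_simps power2_eq_square)
    then have "u (Suc i) = 1" by simp
    then have "skew_power 1 (u (Suc i)) = 0" by (simp add: skew_power_def)
    then show False using sk that by auto
  qed
  have vx_eq: "vprod p x = (\<Prod>c<p. (- 1) ^ c) * vprod p a"
    unfolding x_def a_def by (rule vprod_x_of)
  have vy_eq: "vprod q y = (\<Prod>c<q. (- 1 / 3) ^ c) * (\<Prod>i<q. y i ^ (q - 1)) * vprod q b"
    unfolding y_def b_def using u1 by (intro vprod_y_of) auto
  have vx: "vprod p x \<noteq> 0" using va by (simp add: vx_eq)
  have vy: "vprod q y \<noteq> 0" using vb y0 by (simp add: vy_eq)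
  have x_ne: "x i \<noteq> x j" if "i < j" "j < p" for i j
    using vx that unfolding vprod_nonzero_iff by (auto dest: inj_onD)
  have y_ne: "y i \<noteq> y j" if "i < j" "j < q" for i j
    using vy that unfolding vprod_nonzero_iff by (auto dest: inj_onD)
  have ev0: "\<forall>\<^sub>F \<zeta> :: complex in at (- 2). \<zeta> \<noteq> 0" and ev2: "\<forall>\<^sub>F \<zeta> :: complex in at (- 2). \<zeta> \<noteq> - 2"
    by (rule eventually_neq_at_within)+
  have evQ: "\<forall>\<^sub>F \<zeta> in at (- 2). \<forall>i\<in>{..<p + q}. Q_poly \<zeta> (?w \<zeta> i) \<noteq> 0"
  proof (intro eventually_ball_finite ballI)
    fix i assume i: "i \<in> {..<p + q}"
    show "\<forall>\<^sub>F \<zeta> in at (- 2). Q_poly \<zeta> (?w \<zeta> i) \<noteq> 0"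
    proof (cases "i < p")
      case True
      have "((\<lambda>\<zeta>. (\<zeta> + 2) * x i - \<zeta>) \<longlongrightarrow> (- 2 + 2) * x i - (- 2)) (at (- 2))"
        by (intro tendsto_intros)
      then have "\<forall>\<^sub>F \<zeta> in at (- 2). (\<zeta> + 2) * x i - \<zeta> \<noteq> 0"
        by (rule tendsto_imp_eventually_ne) simp
      then show ?thesis using True by (simp add: Q_poly_def join0_def)
    next
      case False
      have "y (i - p) \<noteq> 1" using y1 i False by auto
      show ?thesis using ev0 ev2
      proof eventually_elim
        case (elim \<zeta>)
        have "\<zeta> + 2 \<noteq> 0" using elim by (simp add: add_eq_0_iff2)
        then have "(\<zeta> + 2) * (\<zeta> * y (i - p) / (\<zeta> + 2)) = \<zeta> * y (i - p)" by simp
        then have "Q_poly \<zeta> (?w \<zeta> i) = \<zeta> * (y (i - p) - 1)"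
          using False by (simp only: Q_poly_def join0_def if_False right_diff_distrib mult_1_right)
        then show ?case using elim \<open>y (i - p) \<noteq> 1\<close> by simp
      qed
    qed
  qed simp
  have evG: "\<forall>\<^sub>F \<zeta> in at (- 2). \<forall>i\<in>{..<p + q}. \<forall>j\<in>{..<p + q}. i < j \<longrightarrow>
      ?w \<zeta> i \<noteq> ?w \<zeta> j \<and> G_poly \<zeta> (?w \<zeta> i) (?w \<zeta> j) \<noteq> 0"
  proof (intro eventually_ball_finite ballI)
    fix i j assume "i \<in> {..<p + q}" "j \<in> {..<p + q}"
    then have ij: "i < p + q" "j < p + q" by auto
    show "\<forall>\<^sub>F \<zeta> in at (- 2). i < j \<longrightarrow> ?w \<zeta> i \<noteq> ?w \<zeta> j \<and> G_poly \<zeta> (?w \<zeta> i) (?w \<zeta> j) \<noteq> 0"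
    proof (cases "i < j")
      case True
      consider "j < p" | "i < p" "p \<le> j" | "p \<le> i" using True by linarith
      then show ?thesis
      proof cases
        case 1
        then have "x i \<noteq> x j" using x_ne True by simp
        with eventually_G_poly_nonzero[OF this, of "- 2"] show ?thesis
          using 1 True by (auto simp: join0_def elim: eventually_mono)
      next
        case 2
        have yj: "y (j - p) \<noteq> 0" using y0 2 ij by simp
        have "((\<lambda>\<zeta>. (\<zeta> + 2) * x i - \<zeta> * y (j - p)) \<longlongrightarrow> (- 2 + 2) * x i - (- 2) * y (j - p)) (at (- 2))"
          by (intro tendsto_intros)
        then have "\<forall>\<^sub>F \<zeta> in at (- 2). (\<zeta> + 2) * x i - \<zeta> * y (j - p) \<noteq> 0"
          by (rule tendsto_imp_eventually_ne) (use yj in simp)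
        with eventually_G_poly_nonzero_mixed[OF yj, of "x i"] ev2 show ?thesis
        proof eventually_elim
          case (elim \<zeta>)
          have "\<zeta> + 2 \<noteq> 0" using elim by (simp add: add_eq_0_iff2)
          then have "x i \<noteq> \<zeta> * y (j - p) / (\<zeta> + 2)" using elim by (auto simp: field_simps)
          then show ?case using elim 2 by (simp add: join0_def)
        qed
      next
        case 3
        have yij: "y (i - p) \<noteq> 0" "y (j - p) \<noteq> 0" "y (i - p) \<noteq> y (j - p)"
          using y0 y_ne 3 ij True by auto
        show ?thesis
          using eventually_G_poly_nonzero_infinite[OF yij(1,2)] ev0 ev2
        proof eventually_elim
          case (elim \<zeta>)
          have "\<zeta> + 2 \<noteq> 0" using elim by (simp add: add_eq_0_iff2)
          then show ?case using elim 3 True yij by (simp add: join0_def)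
        qed
      qed
    qed simp
  qed simp_all
  let ?K = "\<Sum>c<q. (p + c + 1) div 2" and ?V = "\<Sum>i<q. p + i" and ?T = "\<Sum>c<q. col_order (p + c)"
  have T: "?T = ?V + ?K"
    unfolding col_order_eq sum.distrib[symmetric] by simp
  have ev: "\<forall>\<^sub>F \<zeta> in at (- 2).
    ((\<zeta> + 2) ^ ?T * fdet (p + q) (\<lambda>i c. S_col \<zeta> n c (?w \<zeta> i))) / ((\<zeta> + 2) ^ ?V * vprod (p + q) (?w \<zeta>)) =
    (\<zeta> + 2) ^ ?K * S_poly n \<zeta> (v \<zeta>)"
    using evQ evG ev2
  proof eventually_elim
    case (elim \<zeta>)
    have e: "\<zeta> + 2 \<noteq> 0" using elim by (simp add: add_eq_0_iff2)
    have inj: "inj_on (?w \<zeta>) {..<p + q}"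
      by (rule linorder_inj_onI') (use elim in auto)
    then have nz: "vprod (p + q) (?w \<zeta>) \<noteq> 0" by (simp add: vprod_nonzero_iff)
    have "S_poly n \<zeta> (v \<zeta>) * vprod (2 * n + 1) (\<lambda>i. v \<zeta> (Suc i)) =
      fdet (2 * n + 1) (\<lambda>i c. S_col \<zeta> n c (v \<zeta> (Suc i)))"
      by (rule S_poly_eq) (use elim inj in \<open>auto simp: v_w pq[symmetric] simp del: One_nat_def\<close>)
    then have "fdet (p + q) (\<lambda>i c. S_col \<zeta> n c (?w \<zeta> i)) = S_poly n \<zeta> (v \<zeta>) * vprod (p + q) (?w \<zeta>)"
      by (simp only: v_w pq)
    then show ?case
      unfolding T power_add using e nz by simp
  qed
  have "((\<lambda>\<zeta>. ((\<zeta> + 2) ^ ?T * fdet (p + q) (\<lambda>i c. S_col \<zeta> n c (?w \<zeta> i))) /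
      ((\<zeta> + 2) ^ ?V * vprod (p + q) (?w \<zeta>))) \<longlongrightarrow>
    fdet p (\<lambda>i c. S_col (- 2) n c (x i)) * fdet q (\<lambda>i c. S_col_top n (p + c) (y i)) /
      (vprod p x * ((\<Prod>i<q. (- 2) ^ (p + i) * y i ^ p) * vprod q y))) (at (- 2))"
    by (intro tendsto_divide tendsto_fdet_S_col tendsto_vprod) (use vx vy y0 in auto)
  then have lim: "((\<lambda>\<zeta>. (\<zeta> + 2) ^ ?K * S_poly n \<zeta> (v \<zeta>)) \<longlongrightarrow>
    fdet p (\<lambda>i c. S_col (- 2) n c (x i)) * fdet q (\<lambda>i c. S_col_top n (p + c) (y i)) /
      (vprod p x * ((\<Prod>i<q. (- 2) ^ (p + i) * y i ^ p) * vprod q y))) (at (- 2))"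
    using ev by (rule Lim_transform_eventually)
  let ?A = "alt_det p (\<lambda>i. (a i)\<^sup>2 + a i) (\<lambda>i. t (Suc i) ^ 3 + inverse (t (Suc i)) ^ 3)"
  let ?B = "alt_det q (\<lambda>i. 1 + b i) (\<lambda>i. u (Suc i) ^ 3 + inverse (u (Suc i)) ^ 3)"
  let ?cp = "\<Prod>c<p. 2 ^ (n - c mod 2 - c div 2) * (- 1) ^ (c div 2) :: complex"
  let ?cq = "\<Prod>c<q. (- 1 / 6) ^ (c mod 2) * (- 1 / 108) ^ (c div 2) :: complex"
  have bottom: "fdet p (\<lambda>i c. S_col (- 2) n c (x i)) = ?cp * ?A"
    unfolding x_def a_def by (rule fdet_S_col_bottom) (use t0 in auto)
  have top: "fdet q (\<lambda>i c. S_col_top n (p + c) (y i)) =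
    (\<Prod>c<q. (- 1) ^ c) * (\<Prod>i<q. (- 8 * y i ^ 3) ^ n) * ?cq * ?B"
    unfolding y_def b_def by (rule fdet_S_col_top[OF pq]) (use u0 b1 in \<open>auto simp: b_def\<close>)
  have so_eq: "so_char p l t = ?A / vprod p a"
    unfolding a_def by (rule so_char_eq) (use t0 so l in auto)
  have sp_eq: "sp_char q l' u = ?B / vprod q b"
    unfolding b_def by (rule sp_char_eq) (use u0 sp l' in auto)
  \<comment> \<open>Since 3 n = p + (q - 1) + n, the powers of y split into those cancelled by the
    mixed differences, those cancelled by the Vandermonde product of the y_i, and an n-th power that
    produces the factor 1/(1 + b)^n.\<close>
  have y_prod: "(\<Prod>i<q. (- 8 * y i ^ 3) ^ n) =
    (\<Prod>i<q. y i ^ p) * (\<Prod>i<q. y i ^ (q - 1)) * ((- 24) ^ (n * q) * (\<Prod>i<q. 1 / (1 + b i) ^ n))"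
  proof -
    have "(\<Prod>i<q. (- 8 * y i ^ 3) ^ n) = (\<Prod>i<q. y i ^ p * y i ^ (q - 1) * ((- 24) ^ n * (1 / (1 + b i) ^ n)))"
    proof (intro prod.cong refl)
      fix i assume "i \<in> {..<q}"
      then have "3 * n = p + (q - 1) + n" using pq by auto
      then have "(y i ^ 3) ^ n = y i ^ p * y i ^ (q - 1) * y i ^ n"
        by (simp only: power_mult[symmetric] power_add[symmetric])
      moreover have "(- 8) ^ n * y i ^ n = (- 24) ^ n * (1 / (1 + b i) ^ n)"
      proof -
        have "(- 8) ^ n * y i ^ n = (- 24 / (1 + b i)) ^ n"
          by (simp add: y_eq flip: power_mult_distrib)
        then show ?thesis by (simp only: power_divide times_divide_eq_right mult_1_right)
      qed
      moreover have "(- 8) ^ n * (y i ^ p * y i ^ (q - 1) * y i ^ n) =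
        y i ^ p * y i ^ (q - 1) * ((- 8) ^ n * y i ^ n)" by simp
      ultimately show "(- 8 * y i ^ 3) ^ n = y i ^ p * y i ^ (q - 1) * ((- 24) ^ n * (1 / (1 + b i) ^ n))"
        by (simp only: power_mult_distrib)
    qed
    then show ?thesis by (simp only: prod.distrib prod_constant card_lessThan power_mult)
  qed
  have fin_prod: "(\<Prod>i=1..q. 1 / (1 + u i + inverse (u i)) ^ n) = (\<Prod>i<q. 1 / (1 + b i) ^ n)"
    by (simp add: prod.atLeast1_atMost_eq b_def add.assoc)
  have sign: "1 / (\<Prod>c<p. (- 1) ^ c) = (\<Prod>c<p. (- 1) ^ c :: complex)"
    unfolding minus_one_power_triangular[symmetric] by (simp add: minus_one_power_iff)
  have const: "limit_const p q n = ?cp * (\<Prod>c<p. (- 1) ^ c) * ((\<Prod>c<q. (- 1) ^ c) * ?cq /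
      ((\<Prod>i<q. (- 2) ^ (p + i)) * (\<Prod>c<q. (- 1 / 3) ^ c))) * (- 24) ^ (n * q)"
    unfolding limit_const_def by (simp only: prod.distrib prod_dividef mult.assoc)
  have alg: "cp * A * (s * (P1 * P2 * (k * f)) * cq * B) / (sx * va' * ((m2 * P1) * (m3 * P2 * vb'))) =
      cp * sx * (s * cq / (m2 * m3)) * k * f * (A / va') * (B / vb')"
    if "1 / sx = sx" "P1 \<noteq> 0" "P2 \<noteq> 0" for cp A s P1 P2 k f cq B sx va' m2 m3 vb' :: complex
  proof -
    have "cp * A * (s * (P1 * P2 * (k * f)) * cq * B) / (sx * va' * ((m2 * P1) * (m3 * P2 * vb'))) =
      cp * (1 / sx) * (s * cq / (m2 * m3)) * k * f * (A / va') * (B / vb')"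
      using that(2,3) by (simp add: mult_ac)
    then show ?thesis using that(1) by simp
  qed
  have "fdet p (\<lambda>i c. S_col (- 2) n c (x i)) * fdet q (\<lambda>i c. S_col_top n (p + c) (y i)) /
      (vprod p x * ((\<Prod>i<q. (- 2) ^ (p + i) * y i ^ p) * vprod q y)) =
    limit_const p q n * (\<Prod>i=1..q. 1 / (1 + u i + inverse (u i)) ^ n) * so_char p l t * sp_char q l' u"
    unfolding bottom top y_prod vx_eq vy_eq so_eq sp_eq fin_prod const prod.distrib[of "\<lambda>i. (- 2) ^ (p + i)"]
    by (rule alg[OF sign]) (use y0 in auto)
  with lim show ?thesis by (simp add: v_def)
qed

section \<open>The constant\<close>

text \<open>The factors c = 2 m and c = 2 m + 1 are combined: their product is (-3/2)(-1/6) = 1/4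
  times 48^(-2 m), with 48^2 = 2^8 3^2. Integer exponents are used because they become
  negative.\<close>

lemma limit_const_prod_q:
  "(\<Prod>c<2 * m. (- 3 / 2) ^ c * (- 1 / 6) ^ (c mod 2) * (- 1 / 108) ^ (c div 2) :: complex) =
    2 powi (2 * int m - 4 * (int m)\<^sup>2) * 3 powi (int m - (int m)\<^sup>2)"
proof (induction m)
  case (Suc m)
  let ?f = "\<lambda>c. (- 3 / 2) ^ c * (- 1 / 6) ^ (c mod 2) * (- 1 / 108) ^ (c div 2) :: complex"
  have "(\<Prod>c<2 * Suc m. ?f c) = (\<Prod>c<2 * m. ?f c) * (?f (2 * m) * ?f (2 * m + 1))"
    by (simp add: mult.assoc)
  also have "?f (2 * m) * ?f (2 * m + 1) = 1 / 4 * (1 / 2304) ^ m"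
  proof -
    have idx: "2 * m mod 2 = 0" "(2 * m + 1) mod 2 = 1" "2 * m div 2 = m" "(2 * m + 1) div 2 = m" by simp_all
    define X :: complex where "X = (- 3 / 2) ^ (2 * m) * (- 1 / 108) ^ m"
    have "?f (2 * m) = X" "?f (2 * m + 1) = X * ((- 3 / 2) * (- 1 / 6))"
      unfolding idx X_def by (simp_all add: mult_ac)
    then have "?f (2 * m) * ?f (2 * m + 1) = 1 / 4 * (X * X)" by simp
    also have "X * X = ((- 3 / 2)\<^sup>2 * (- 1 / 108) * ((- 3 / 2)\<^sup>2 * (- 1 / 108))) ^ m"
      unfolding X_def by (simp only: power_mult power_mult_distrib)
    also have "(- 3 / 2)\<^sup>2 * (- 1 / 108) * ((- 3 / 2)\<^sup>2 * (- 1 / 108)) = (1 / 2304 :: complex)"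
      by (simp add: power2_eq_square)
    finally show ?thesis .
  qed
  also have "\<dots> = 2 powi (- 2 - 8 * int m) * 3 powi (- 2 * int m)"
  proof -
    have "(2304 :: complex) = 2 ^ 8 * 3 ^ 2" by simp
    then have "(2304 :: complex) ^ m = 2 ^ (8 * m) * 3 ^ (2 * m)"
      by (simp only: power_mult power_mult_distrib)
    moreover have "(2 :: complex) powi (- 2 - 8 * int m) = 1 / 4 / 2 ^ (8 * m)"
    proof -
      have "(2 :: complex) powi (- 2 - 8 * int m) = 2 powi (- 2) / 2 powi (int (8 * m))"
        by (subst power_int_diff) auto
      then show ?thesis by (simp only: power_int_of_nat) (simp add: power_int_minus)
    qed
    moreover have "(3 :: complex) powi (- 2 * int m) = 1 / 3 ^ (2 * m)"
    proof -
      have "- 2 * int m = - int (2 * m)" by simp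
      then show ?thesis by (simp only: power_int_minus power_int_of_nat) (simp add: inverse_eq_divide)
    qed
    ultimately show ?thesis by (simp add: power_divide)
  qed
  finally have "(\<Prod>c<2 * Suc m. ?f c) = 2 powi (2 * int m - 4 * (int m)\<^sup>2) * 3 powi (int m - (int m)\<^sup>2) *
    (2 powi (- 2 - 8 * int m) * 3 powi (- 2 * int m))"
    unfolding Suc .
  also have "\<dots> = 2 powi (2 * int m - 4 * (int m)\<^sup>2 + (- 2 - 8 * int m)) * 3 powi (int m - (int m)\<^sup>2 + - 2 * int m)"
    by (simp only: power_int_add zero_neq_numeral[symmetric] not_False_eq_True simp_thms mult_ac)
  also have "2 * int m - 4 * (int m)\<^sup>2 + (- 2 - 8 * int m) = 2 * int (Suc m) - 4 * (int (Suc m))\<^sup>2"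
    by (simp add: power2_eq_square algebra_simps)
  also have "int m - (int m)\<^sup>2 + - 2 * int m = int (Suc m) - (int (Suc m))\<^sup>2"
    by (simp add: power2_eq_square algebra_simps)
  finally show ?case .
qed simp

text \<open>The columns 2 k and 2 k + 1 together give -1 times the power 2 n - 2 k - 1 of 2; k < n
  keeps both exponents untruncated.\<close>

lemma limit_const_prod_p:
  assumes "k \<le> n"
  shows "(\<Prod>c<2 * k. 2 ^ (n - c mod 2 - c div 2) * (- 1) ^ (c div 2) * (- 1) ^ c :: complex) =
    (- 1) ^ k * 2 powi (2 * int n * int k - (int k)\<^sup>2)"
  using assms
proof (induction k)
  case (Suc k)
  let ?f = "\<lambda>c. 2 ^ (n - c mod 2 - c div 2) * (- 1) ^ (c div 2) * (- 1) ^ c :: complex"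
  have "(\<Prod>c<2 * Suc k. ?f c) = (\<Prod>c<2 * k. ?f c) * (?f (2 * k) * ?f (2 * k + 1))"
    by (simp add: mult.assoc)
  also have "?f (2 * k) * ?f (2 * k + 1) = - (2 ^ (n - k + (n - 1 - k)) * ((- 1) ^ k * (- 1) ^ k))"
  proof -
    have idx: "2 * k mod 2 = 0" "(2 * k + 1) mod 2 = 1" "2 * k div 2 = k" "(2 * k + 1) div 2 = k" by simp_all
    show ?thesis unfolding idx by (simp add: power_add mult_ac)
  qed
  also have "\<dots> = - (2 powi (2 * int n - 2 * int k - 1))"
  proof -
    have "int (n - k + (n - 1 - k)) = 2 * int n - 2 * int k - 1" using Suc.prems by auto
    then have "(2 :: complex) powi (2 * int n - 2 * int k - 1) = 2 ^ (n - k + (n - 1 - k))"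
      by (metis power_int_of_nat)
    then show ?thesis by (simp flip: power_mult_distrib)
  qed
  finally have "(\<Prod>c<2 * Suc k. ?f c) =
    (- 1) ^ Suc k * 2 powi (2 * int n * int k - (int k)\<^sup>2 + (2 * int n - 2 * int k - 1))"
    using Suc by (simp add: power_int_add)
  also have "2 * int n * int k - (int k)\<^sup>2 + (2 * int n - 2 * int k - 1) =
    2 * int n * int (Suc k) - (int (Suc k))\<^sup>2"
    by (simp add: power2_eq_square algebra_simps)
  finally show ?case .
qed simp

lemma limit_const_eq:
  "limit_const p q n = (\<Prod>c<p. 2 ^ (n - c mod 2 - c div 2) * (- 1) ^ (c div 2) * (- 1) ^ c) *
    ((\<Prod>c<q. (- 3 / 2) ^ c * (- 1 / 6) ^ (c mod 2) * (- 1 / 108) ^ (c div 2)) / (- 2) ^ (p * q)) *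
    (- 24) ^ (n * q)"
proof -
  have "(\<Prod>c<q. (- 1) ^ c * (- 1 / 6) ^ (c mod 2) * (- 1 / 108) ^ (c div 2) / ((- 2) ^ (p + c) * (- 1 / 3) ^ c)) =
    (\<Prod>c<q. (- 3 / 2) ^ c * (- 1 / 6) ^ (c mod 2) * (- 1 / 108) ^ (c div 2) / (- 2) ^ p :: complex)"
  proof (intro prod.cong refl)
    fix c :: nat
    have "(- 1) ^ c / ((- 2) ^ c * (- 1 / 3) ^ c) = (- 3 / 2 :: complex) ^ c"
      by (simp flip: power_mult_distrib power_divide)
    moreover have "s * a * b / (m * k * r) = s / (k * r) * a * b / m" for s a b m k r :: complex
      by simp
    ultimately show "(- 1) ^ c * (- 1 / 6) ^ (c mod 2) * (- 1 / 108) ^ (c div 2) / ((- 2) ^ (p + c) * (- 1 / 3) ^ c) =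
      (- 3 / 2) ^ c * (- 1 / 6) ^ (c mod 2) * (- 1 / 108) ^ (c div 2) / (- 2 :: complex) ^ p"
      unfolding power_add by metis
  qed
  then show ?thesis
    unfolding limit_const_def by (simp only: prod_dividef prod_constant card_lessThan power_mult)
qed

lemma limit_const_even:
  "limit_const (2 * k + 1) (2 * m) (m + k) =
    2 ^ ((2 * m + (m + k)) * (m + k) - m * (m - 1)) * 3 ^ (2 * m * (m + k) - m * (m - 1))"
proof -
  define M K where "M = int m" and "K = int k"
  have p: "(\<Prod>c<2 * k + 1. 2 ^ (m + k - c mod 2 - c div 2) * (- 1) ^ (c div 2) * (- 1) ^ c :: complex) =
    2 powi (2 * (M + K) * K - K\<^sup>2) * 2 powi M"
  proof -
    \<comment> \<open>The unpaired column c = 2 k contributes 2^m and (-1)^k, which cancels the sign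
      of the k pairs.\<close>
    have "(- 1) ^ k * (- 1) ^ k = (1 :: complex)" by (simp flip: power_mult_distrib)
    then show ?thesis
      using limit_const_prod_p[of k "m + k"] by (simp add: M_def K_def mult_ac)
  qed
  have two: "(- 2 :: complex) ^ ((2 * k + 1) * (2 * m)) = 2 powi ((2 * K + 1) * (2 * M))"
  proof -
    have "(2 * K + 1) * (2 * M) = int ((2 * k + 1) * (2 * m))" by (simp add: M_def K_def algebra_simps)
    then show ?thesis by (simp only: power_int_of_nat) simp
  qed
  have tf: "(- 24 :: complex) ^ ((m + k) * (2 * m)) = 2 powi (6 * (M + K) * M) * 3 powi (2 * (M + K) * M)"
  proof -
    have "(- 24 :: complex) ^ ((m + k) * (2 * m)) = (2 ^ 3 * 3) ^ ((m + k) * (2 * m))" by simp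
    also have "\<dots> = 2 ^ (3 * ((m + k) * (2 * m))) * 3 ^ ((m + k) * (2 * m))"
      by (simp only: power_mult_distrib power_mult)
    also have "\<dots> = 2 powi int (3 * ((m + k) * (2 * m))) * 3 powi int ((m + k) * (2 * m))"
      by (simp only: power_int_of_nat)
    finally show ?thesis by (simp add: M_def K_def algebra_simps)
  qed
  have "limit_const (2 * k + 1) (2 * m) (m + k) =
    2 powi (2 * (M + K) * K - K\<^sup>2) * 2 powi M * (2 powi (2 * M - 4 * M\<^sup>2) * 3 powi (M - M\<^sup>2) /
      2 powi ((2 * K + 1) * (2 * M))) * (2 powi (6 * (M + K) * M) * 3 powi (2 * (M + K) * M))"
    unfolding limit_const_eq p two tf limit_const_prod_q M_def ..
  also have "\<dots> = 2 powi (2 * (M + K) * K - K\<^sup>2 + M + (2 * M - 4 * M\<^sup>2) - (2 * K + 1) * (2 * M) + 6 * (M + K) * M)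
    * 3 powi (M - M\<^sup>2 + 2 * (M + K) * M)"
    by (simp only: power_int_add power_int_diff zero_neq_numeral[symmetric] not_False_eq_True simp_thms) (simp add: mult_ac)
  also have "2 * (M + K) * K - K\<^sup>2 + M + (2 * M - 4 * M\<^sup>2) - (2 * K + 1) * (2 * M) + 6 * (M + K) * M =
    int ((2 * m + (m + k)) * (m + k) - m * (m - 1))"
  proof -
    have "(2 * m + (m + k)) * (m + k) - m * (m - 1) = 2 * m * m + 4 * m * k + k * k + m"
      by (cases m) (auto simp: algebra_simps)
    then show ?thesis by (simp add: M_def K_def power2_eq_square algebra_simps)
  qed
  also have "M - M\<^sup>2 + 2 * (M + K) * M = int (2 * m * (m + k) - m * (m - 1))"
  proof -
    have "2 * m * (m + k) - m * (m - 1) = m * m + 2 * m * k + m"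
      by (cases m) (auto simp: algebra_simps)
    then show ?thesis by (simp add: M_def K_def power2_eq_square algebra_simps)
  qed
  finally show ?thesis by (simp only: power_int_of_nat)
qed

lemma limit_const_odd:
  "limit_const (2 * k) (2 * m + 1) (m + k) =
    2 ^ ((2 * m + (m + k) + 1) * (m + k) - m\<^sup>2) * 3 ^ ((2 * m + 1) * (m + k) - m\<^sup>2)"
proof -
  define M K where "M = int m" and "K = int k"
  have p: "(\<Prod>c<2 * k. 2 ^ (m + k - c mod 2 - c div 2) * (- 1) ^ (c div 2) * (- 1) ^ c :: complex) =
    (- 1) ^ k * 2 powi (2 * (M + K) * K - K\<^sup>2)"
    using limit_const_prod_p[of k "m + k"] by (simp add: M_def K_def)
  have q: "(\<Prod>c<2 * m + 1. (- 3 / 2) ^ c * (- 1 / 6) ^ (c mod 2) * (- 1 / 108) ^ (c div 2) :: complex) =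
    2 powi (2 * M - 4 * M\<^sup>2) * 3 powi (M - M\<^sup>2) * ((- 1) ^ m / (2 powi (4 * M) * 3 powi M))"
  proof -
    \<comment> \<open>The unpaired column c = 2 m, with (9/4)(-1/108) = -1/48.\<close>
    have "(- 3 / 2) ^ (2 * m) * (- 1 / 108) ^ m = (- 1 / (2 ^ 4 * 3) :: complex) ^ m"
      by (simp only: power_mult power_mult_distrib[symmetric]) (simp add: power2_eq_square)
    also have "\<dots> = (- 1) ^ m / (2 ^ (4 * m) * 3 ^ m)"
      by (simp only: power_divide power_mult_distrib power_mult)
    also have "(2 :: complex) ^ (4 * m) * 3 ^ m = 2 powi int (4 * m) * 3 powi int m"
      by (simp only: power_int_of_nat)
    finally show ?thesis
      using limit_const_prod_q[of m] by (simp add: M_def mult.assoc)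
  qed
  have two: "(- 2 :: complex) ^ (2 * k * (2 * m + 1)) = 2 powi (2 * K * (2 * M + 1))"
  proof -
    have "2 * K * (2 * M + 1) = int (2 * k * (2 * m + 1))" by (simp add: M_def K_def algebra_simps)
    then show ?thesis by (simp only: power_int_of_nat) (simp add: power_mult)
  qed
  have tf: "(- 24 :: complex) ^ ((m + k) * (2 * m + 1)) =
    (- 1) ^ (m + k) * (2 powi (3 * (M + K) * (2 * M + 1)) * 3 powi ((M + K) * (2 * M + 1)))"
  proof -
    have "(- 24 :: complex) ^ ((m + k) * (2 * m + 1)) = ((- 1) * (2 ^ 3 * 3)) ^ ((m + k) * (2 * m + 1))" by simp
    also have "\<dots> = (- 1) ^ ((m + k) * (2 * m + 1)) * (2 ^ (3 * ((m + k) * (2 * m + 1))) * 3 ^ ((m + k) * (2 * m + 1)))"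
      by (simp only: power_mult_distrib power_mult)
    also have "\<dots> = (- 1) ^ ((m + k) * (2 * m + 1)) *
      (2 powi int (3 * ((m + k) * (2 * m + 1))) * 3 powi int ((m + k) * (2 * m + 1)))"
      by (simp only: power_int_of_nat)
    also have "(- 1 :: complex) ^ ((m + k) * (2 * m + 1)) = (- 1) ^ (m + k)"
      by (simp add: minus_one_power_iff)
    also have "int (3 * ((m + k) * (2 * m + 1))) = 3 * (M + K) * (2 * M + 1)"
      by (simp add: M_def K_def algebra_simps)
    also have "int ((m + k) * (2 * m + 1)) = (M + K) * (2 * M + 1)"
      by (simp add: M_def K_def algebra_simps)
    finally show ?thesis .
  qed
  \<comment> \<open>The signs of the k pairs, of the unpaired column and of the odd power of
    (-24)^(m+k) cancel.\<close>
  have sign: "(- 1) ^ k * (- 1) ^ m * (- 1) ^ (m + k) = (1 :: complex)"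
    by (simp add: minus_one_power_iff)
  have "limit_const (2 * k) (2 * m + 1) (m + k) =
    (- 1) ^ k * 2 powi (2 * (M + K) * K - K\<^sup>2) * (2 powi (2 * M - 4 * M\<^sup>2) * 3 powi (M - M\<^sup>2) *
      ((- 1) ^ m / (2 powi (4 * M) * 3 powi M)) / 2 powi (2 * K * (2 * M + 1))) *
    ((- 1) ^ (m + k) * (2 powi (3 * (M + K) * (2 * M + 1)) * 3 powi ((M + K) * (2 * M + 1))))"
    unfolding limit_const_eq p q two tf ..
  also have "\<dots> = ((- 1) ^ k * (- 1) ^ m * (- 1) ^ (m + k)) *
    (2 powi (2 * (M + K) * K - K\<^sup>2) * 2 powi (2 * M - 4 * M\<^sup>2) / 2 powi (4 * M) / 2 powi (2 * K * (2 * M + 1)) *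
      2 powi (3 * (M + K) * (2 * M + 1))) *
    (3 powi (M - M\<^sup>2) / 3 powi M * 3 powi ((M + K) * (2 * M + 1)))"
    by (simp add: mult_ac)
  also have "\<dots> = 2 powi (2 * (M + K) * K - K\<^sup>2 + (2 * M - 4 * M\<^sup>2) - 4 * M - 2 * K * (2 * M + 1) + 3 * (M + K) * (2 * M + 1))
    * 3 powi (M - M\<^sup>2 - M + (M + K) * (2 * M + 1))"
    unfolding sign by (simp only: power_int_add power_int_diff zero_neq_numeral[symmetric] not_False_eq_True simp_thms) (simp add: mult_ac)
  also have "2 * (M + K) * K - K\<^sup>2 + (2 * M - 4 * M\<^sup>2) - 4 * M - 2 * K * (2 * M + 1) + 3 * (M + K) * (2 * M + 1) =
    int ((2 * m + (m + k) + 1) * (m + k) - m\<^sup>2)"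
  proof -
    have "(2 * m + (m + k) + 1) * (m + k) - m\<^sup>2 = 2 * m * m + 4 * m * k + k * k + m + k"
      by (simp add: algebra_simps power2_eq_square)
    then show ?thesis by (simp add: M_def K_def power2_eq_square algebra_simps)
  qed
  also have "M - M\<^sup>2 - M + (M + K) * (2 * M + 1) = int ((2 * m + 1) * (m + k) - m\<^sup>2)"
  proof -
    have "(2 * m + 1) * (m + k) - m\<^sup>2 = m * m + 2 * m * k + m + k"
      by (simp add: algebra_simps power2_eq_square)
    then show ?thesis by (simp add: M_def K_def power2_eq_square algebra_simps)
  qed
  finally show ?thesis by (simp only: power_int_of_nat)
qed

section \<open>The exponent of \<zeta> + 2 and the specialisation to the two parities\<close>

lemma exponent_even:
  fixes m k :: nat
  shows
  "(\<Sum>c<2 * m. (2 * k + 1 + c + 1) div 2) = 2 * m * (m + k) - m * (m - 1)"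
proof -
  have "(\<Sum>c<2 * m. (2 * k + 1 + c + 1) div 2) = m * m + 2 * m * k + m"
    by (induction m) (auto simp: algebra_simps)
  then show ?thesis by (cases m) (auto simp: algebra_simps)
qed

lemma exponent_odd:
  fixes m k :: nat
  shows
  "(\<Sum>c<2 * m + 1. (2 * k + c + 1) div 2) = (2 * m + 1) * (m + k) - m\<^sup>2"
proof -
  have "(\<Sum>c<2 * m + 1. (2 * k + c + 1) div 2) = m * m + 2 * m * k + m + k"
    by (induction m) (auto simp: algebra_simps)
  then show ?thesis by (simp add: algebra_simps power2_eq_square)
qed

theorem theorem7p17:
  fixes n m :: nat
  assumes "m \<le> n"
  shows
    "(\<forall>t u. regular_point (2 * n + 1 - 2 * m) (2 * m) t u \<longrightarrow>
        ((\<lambda>\<zeta>. (\<zeta> + 2) ^ (2 * m * n - m * (m - 1)) *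
              S_poly n \<zeta> (join_args (2 * n + 1 - 2 * m) (\<lambda>i. x_of (t i))
                                    (\<lambda>i. \<zeta> * y_of (u i) / (\<zeta> + 2))))
         \<longlongrightarrow>
         2 ^ ((2 * m + n) * n - m * (m - 1)) * 3 ^ (2 * m * n - m * (m - 1)) *
         (\<Prod>i=1..2*m. 1 / (1 + u i + inverse (u i)) ^ n) *
         so_char (2 * n + 1 - 2 * m) (pairs_part (n - m)) t *
         sp_char (2 * m) (pairs_part (m - 1)) u) (at (- 2)))
     \<and>
     (\<forall>t u. regular_point (2 * n - 2 * m) (2 * m + 1) t u \<longrightarrow>
        ((\<lambda>\<zeta>. (\<zeta> + 2) ^ ((2 * m + 1) * n - m\<^sup>2) *
              S_poly n \<zeta> (join_args (2 * n - 2 * m) (\<lambda>i. x_of (t i))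
                                    (\<lambda>i. \<zeta> * y_of (u i) / (\<zeta> + 2))))
         \<longlongrightarrow>
         2 ^ ((2 * m + n + 1) * n - m\<^sup>2) * 3 ^ ((2 * m + 1) * n - m\<^sup>2) *
         (\<Prod>i=1..2*m+1. 1 / (1 + u i + inverse (u i)) ^ n) *
         so_char (2 * n - 2 * m) (single_pairs_part (n - m)) t *
         sp_char (2 * m + 1) (single_pairs_part m) u) (at (- 2)))"
proof (intro conjI allI impI)
  obtain k where n: "n = m + k" using assms le_Suc_ex by blast
  fix t u :: "nat \<Rightarrow> complex"
  have p1: "2 * n + 1 - 2 * m = 2 * k + 1" and p2: "2 * n - 2 * m = 2 * k" and k: "n - m = k"
    using n by auto
  {
    assume reg: "regular_point (2 * n + 1 - 2 * m) (2 * m) t u"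
    have l: "pairs_part k (2 * k + 1 - c) = (c + 1) div 2" if "c < 2 * k + 1" for c
      using that unfolding pairs_part_def by linarith
    \<comment> \<open>For m = 0 the truncated value m - 1 = 0 is harmless: there are no
      u-variables.\<close>
    have l': "pairs_part (m - 1) (2 * m - c) = c div 2" if "c < 2 * m" for c
      using that unfolding pairs_part_def by linarith
    show "((\<lambda>\<zeta>. (\<zeta> + 2) ^ (2 * m * n - m * (m - 1)) *
              S_poly n \<zeta> (join_args (2 * n + 1 - 2 * m) (\<lambda>i. x_of (t i))
                                    (\<lambda>i. \<zeta> * y_of (u i) / (\<zeta> + 2))))
         \<longlongrightarrow>
         2 ^ ((2 * m + n) * n - m * (m - 1)) * 3 ^ (2 * m * n - m * (m - 1)) *
         (\<Prod>i=1..2*m. 1 / (1 + u i + inverse (u i)) ^ n) *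
         so_char (2 * n + 1 - 2 * m) (pairs_part (n - m)) t *
         sp_char (2 * m) (pairs_part (m - 1)) u) (at (- 2))"
      using S_poly_limit[of "2 * k + 1" "2 * m" "m + k" t u "pairs_part k" "pairs_part (m - 1)", OF _ _ l l'] reg
      unfolding p1 k unfolding n exponent_even limit_const_even by simp
  next
    assume reg: "regular_point (2 * n - 2 * m) (2 * m + 1) t u"
    have l: "single_pairs_part k (2 * k - c) = (c + 1) div 2" if "c < 2 * k" for c
      using that unfolding single_pairs_part_def by linarith
    have l': "single_pairs_part m (2 * m + 1 - c) = c div 2" if "c < 2 * m + 1" for c
      using that unfolding single_pairs_part_def by linarith
    show "((\<lambda>\<zeta>. (\<zeta> + 2) ^ ((2 * m + 1) * n - m\<^sup>2) *
              S_poly n \<zeta> (join_args (2 * n - 2 * m) (\<lambda>i. x_of (t i))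
                                    (\<lambda>i. \<zeta> * y_of (u i) / (\<zeta> + 2))))
         \<longlongrightarrow>
         2 ^ ((2 * m + n + 1) * n - m\<^sup>2) * 3 ^ ((2 * m + 1) * n - m\<^sup>2) *
         (\<Prod>i=1..2*m+1. 1 / (1 + u i + inverse (u i)) ^ n) *
         so_char (2 * n - 2 * m) (single_pairs_part (n - m)) t *
         sp_char (2 * m + 1) (single_pairs_part m) u) (at (- 2))"
      using S_poly_limit[of "2 * k" "2 * m + 1" "m + k" t u "single_pairs_part k" "single_pairs_part m", OF _ _ l l'] reg
      unfolding p2 k unfolding n exponent_odd limit_const_odd by simp
  }
qed

end
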